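(* For a generic $2\times 2$ game $X$ with payoff matrices $(a_{ij})$ and $(b_{ij})$, the curve of dependency equilibria $\mathcal{V}_X\cap\Delta$ has either $0$, $1$ or $2$ connected components, each of which is an arc between two boundary points. Consider the condition $$\mathrm{sign}(a_{11}-a_{21})=\mathrm{sign}(a_{22}-a_{12})\quad\text{and}\quad \mathrm{sign}(b_{11}-b_{12})=\mathrm{sign}(b_{22}-b_{21}).\qquad( * )$$ If $( * )$ holds, then there is exactly one arc (connected component), and it is an $EE$, $EF$ or $FF$ arc. If $( * )$ does not hold, then all components are $EF$ arcs, and their number can be $0$, $1$ or $2$ (each of these values occurs).
   Context: A $2\times2$ game $X$ is a pair of real $2\times 2$ matrices $X^{(1)}=(a_{ij})$, $X^{(2)}=(b_{ij})$. "Generic" means: for all $(a_{ij},b_{ij})$ outside a proper Zariski closed subset of $\mathbb{R}^8$. Let $\mathbb{P}^3$ be the projective space of $2\times 2$ matrices $P=(p_{ij})$ up to scaling, and $\Delta\subset\mathbb{P}^3$ the open simplex of real matrices with all entries positive (normalized to have entry sum $1$). The Spohn variety $\mathcal{V}_X\subset\mathbb{P}^3$ is defined by $\det M_1=\det M_2=0$, where $$M_1=\begin{bmatrix}p_{11}+p_{12}& a_{11}p_{11}+a_{12}p_{12}\\ p_{21}+p_{22}& a_{21}p_{21}+a_{22}p_{22}\end{bmatrix},\qquad M_2=\begin{bmatrix}p_{11}+p_{21}& b_{11}p_{11}+b_{21}p_{21}\\ p_{12}+p_{22}& b_{12}p_{12}+b_{22}p_{22}\end{bmatrix}.$$ For generic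 $X$ it is a smooth irreducible curve. It contains the four coordinate points $E_{11},E_{12},E_{21},E_{22}$ of $\mathbb{P}^3$ ($E_{ij}$ has its only nonzero entry in position $(i,j)$), and it meets each coordinate plane $\{p_{ij}=0\}$ in exactly one further point that is not a coordinate point, denoted $F_{ij}$. The boundary points at the ends of an arc of $\mathcal{V}_X\cap\Delta$ are points of the boundary of the simplex $\Delta$. An arc is called an $EE$ arc if both of its endpoints are among the points $E_{ij}$, an $FF$ arc if both endpoints are among the points $F_{ij}$, and an $EF$ arc if one endpoint is some $E_{ij}$ and the other is some $F_{kl}$. *)

theory Defs
  imports "HOL-Analysis.Analysis"
begin

text \<open>A game is the pair of its payoff matrices; the type is a copy of the affine space of dimension 8.\<close>

type_synonym game = "(real^2^2) \<times> (real^2^2)"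

text \<open>
  On a Euclidean space, \<^const>\<open>real_polynomial_function\<close> describes exactly the polynomials in
  the coordinates.
\<close>

definition zariski_closed :: "'a::euclidean_space set \<Rightarrow> bool" where
  "zariski_closed Z \<longleftrightarrow>
     (\<exists>F. (\<forall>f\<in>F. real_polynomial_function f) \<and> Z = {x. \<forall>f\<in>F. f x = 0})"

definition M1 :: "game \<Rightarrow> real^2^2 \<Rightarrow> real^2^2" where
  "M1 X P = (let a = fst X in
     vector [vector [P$1$1 + P$1$2, a$1$1 * P$1$1 + a$1$2 * P$1$2],
             vector [P$2$1 + P$2$2, a$2$1 * P$2$1 + a$2$2 * P$2$2]])"

definition M2 :: "game \<Rightarrow> real^2^2 \<Rightarrow> real^2^2" where
  "M2 X P = (let b = snd X in
     vector [vector [P$1$1 + P$2$1, b$1$1 * P$1$1 + b$2$1 * P$2$1],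
             vector [P$1$2 + P$2$2, b$1$2 * P$1$2 + b$2$2 * P$2$2]])"

text \<open>
  A point of projective space is the line \<open>span {P}\<close> through a nonzero matrix \<open>P\<close>. Only real points
  are needed: the simplex is real, and for a generic game the points \<open>F_pt X i j\<close> below are real too.
\<close>

definition spohn_variety :: "game \<Rightarrow> (real^2^2) set set" where
  "spohn_variety X = {span {P} |P. P \<noteq> 0 \<and> det (M1 X P) = 0 \<and> det (M2 X P) = 0}"

definition open_simplex :: "(real^2^2) set" where
  "open_simplex = {P. (\<forall>i j. P$i$j > 0) \<and> (\<Sum>i\<in>UNIV. \<Sum>j\<in>UNIV. P$i$j) = 1}"

definition dependency_equilibria :: "game \<Rightarrow> (real^2^2) set" where
  "dependency_equilibria X = {P \<in> open_simplex. span {P} \<in> spohn_variety X}"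

definition E_pt :: "2 \<Rightarrow> 2 \<Rightarrow> (real^2^2) set" where
  "E_pt i j = span {axis i (axis j 1)}"

text \<open>
  For a generic game the description below determines a unique point; elsewhere \<open>F_pt\<close> is unspecified.
\<close>

definition F_pt :: "game \<Rightarrow> 2 \<Rightarrow> 2 \<Rightarrow> (real^2^2) set" where
  "F_pt X i j = (THE l. l \<in> spohn_variety X \<and> l \<subseteq> {P. P$i$j = 0} \<and> (\<forall>k m. l \<noteq> E_pt k m))"

text \<open>
  The endpoints of an arc lie on the boundary of the simplex and not in the component itself, so a
  component \<open>C\<close> is the arc without its endpoints. The simplex spans only a hyperplane, hence the
  relative frontier.
\<close>

definition open_arc_between :: "(real^2^2) set \<Rightarrow> real^2^2 \<Rightarrow> real^2^2 \<Rightarrow> bool" where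
  "open_arc_between C u v \<longleftrightarrow>
     u \<in> rel_frontier open_simplex \<and> v \<in> rel_frontier open_simplex \<and>
     (\<exists>g. arc g \<and> pathstart g = u \<and> pathfinish g = v \<and> g ` {0<..<1} = C)"

definition is_E :: "real^2^2 \<Rightarrow> bool" where
  "is_E u \<longleftrightarrow> (\<exists>i j. span {u} = E_pt i j)"

definition is_F :: "game \<Rightarrow> real^2^2 \<Rightarrow> bool" where
  "is_F X u \<longleftrightarrow> (\<exists>i j. span {u} = F_pt X i j)"

definition EE_arc :: "(real^2^2) set \<Rightarrow> bool" where
  "EE_arc C \<longleftrightarrow> (\<exists>u v. open_arc_between C u v \<and> is_E u \<and> is_E v)"

definition EF_arc :: "game \<Rightarrow> (real^2^2) set \<Rightarrow> bool" where
  "EF_arc X C \<longleftrightarrow> (\<exists>u v. open_arc_between C u v \<and> is_E u \<and> is_F X v)"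

definition FF_arc :: "game \<Rightarrow> (real^2^2) set \<Rightarrow> bool" where
  "FF_arc X C \<longleftrightarrow> (\<exists>u v. open_arc_between C u v \<and> is_F X u \<and> is_F X v)"

definition sign_condition :: "game \<Rightarrow> bool" where
  "sign_condition X \<longleftrightarrow> (let a = fst X; b = snd X in
     sgn (a$1$1 - a$2$1) = sgn (a$2$2 - a$1$2) \<and>
     sgn (b$1$1 - b$1$2) = sgn (b$2$2 - b$2$1))"

lemma det_M1_scaleR: "det (M1 X (c *\<^sub>R P)) = c\<^sup>2 * det (M1 X P)"
  by (simp add: M1_def Let_def det_2 algebra_simps power2_eq_square)

lemma det_M2_scaleR: "det (M2 X (c *\<^sub>R P)) = c\<^sup>2 * det (M2 X P)"
  by (simp add: M2_def Let_def det_2 algebra_simps power2_eq_square)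

lemma span_in_spohn_variety_iff:
  assumes "P \<noteq> 0"
  shows "span {P} \<in> spohn_variety X \<longleftrightarrow> det (M1 X P) = 0 \<and> det (M2 X P) = 0"
proof
  assume "span {P} \<in> spohn_variety X"
  then obtain Q where Q: "span {P} = span {Q}" "det (M1 X Q) = 0" "det (M2 X Q) = 0"
    unfolding spohn_variety_def by blast
  have "P \<in> span {Q}"
    using Q(1) span_base[of P "{P}"] by simp
  then obtain c where "P = c *\<^sub>R Q"
    by (auto simp: span_singleton)
  with Q show "det (M1 X P) = 0 \<and> det (M2 X P) = 0"
    by (simp add: det_M1_scaleR det_M2_scaleR)
next
  assume "det (M1 X P) = 0 \<and> det (M2 X P) = 0"
  with assms show "span {P} \<in> spohn_variety X"
    unfolding spohn_variety_def by blast
qed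

end

theory Submission
  imports Defs
begin

text \<open>
  Let \<open>x\<close> and \<open>y\<close> be the conditional probabilities of column 1 given row 1 and given row 2, and \<open>z\<close> and
  \<open>w\<close> those of row 1 given column 1 and given column 2. On the open simplex the equation
  \<open>det M1 = 0\<close> says that player 1 expects the same payoff from both rows: it is a linear equation
  between \<open>x\<close> and \<open>y\<close>. Likewise \<open>det M2 = 0\<close> is a linear equation between \<open>z\<close> and \<open>w\<close>. A quadruple
  \<open>(x, y, z, w)\<close> comes from a distribution \<open>P\<close>, and then from exactly one, iff both pairs have the same
  odds ratio, \<open>x (1 - y) / ((1 - x) y) = z (1 - w) / ((1 - z) w)\<close>; both sides are the odds ratio
  \<open>p\<^sub>1\<^sub>1 p\<^sub>2\<^sub>2 / (p\<^sub>1\<^sub>2 p\<^sub>2\<^sub>1)\<close> of \<open>P\<close>. So the curve consists of the pairs formed by a point on a line in one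
  unit square and a point on a line in another unit square at which the odds ratios agree.

  If no two payoffs of a player are equal, the player's line avoids the corners of the square and is not
  parallel to a side. It meets the open square in a chord or not at all. Instead of the odds ratio consider
  \<open>x (1 - y) / (x (1 - y) + (1 - x) y)\<close>, which is continuous up to the ends of the chord. It is 0 on the
  sides \<open>x = 0\<close> and \<open>y = 1\<close>, and 1 on the other two. Along the chord it is a quotient of quadratic
  polynomials, so it takes no value more than twice. Therefore it is a bijection onto \<open>[0, 1]\<close> if it has
  different values at the ends; this means that the line separates the corners \<open>(0, 0)\<close> and \<open>(1, 1)\<close>, which
  is the player's half of \<open>(*)\<close>. Otherwise it is injective on either side of one extremal point (a fold)
  and stays below, respectively above, 1/2 (\<open>chord_share_inj\<close>, \<open>chord_share_fold\<close>, \<open>chord_share_half\<close>).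

  This determines the curve. If one of the two functions is a bijection, the curve is a graph over the
  chord of the other player: one arc. Two folds on different sides of 1/2 share no value: no
  equilibria. For two folds on the same side, the whole curve lies over the chord whose extremal value is closer
  to the value at the ends, and consists of one graph on each side of the fold of the other player: two
  arcs. Here the two extremal values have to be different. An extremal value \<open>k\<close> of the odds ratio belongs
  to a line that is tangent to the conic \<open>x (1 - y) = k (1 - x) y\<close>; this is a quadratic equation for \<open>k\<close>, and
  the resultant of the two quadratic equations vanishes on a proper Zariski closed set only.

  An end of an arc lies over an end of each chord. There one of \<open>x\<close>, \<open>y\<close> is 0 or 1, so an entry of \<open>P\<close>
  vanishes compared to the other entry in its row, and one of \<open>z\<close>, \<open>w\<close> is 0 or 1, so an entry vanishes
  compared to the other one in its column. If it is the same entry, then it is the only zero of \<open>P\<close>, and \<open>P\<close>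
  is an \<open>F\<close> point. If not, then \<open>P\<close> has only one nonzero entry and is an \<open>E\<close> point (\<open>corner_joint\<close>). The two
  ends of a fold lie on two different sides at which the odds ratio is the same. Over a fixed end
  of the other chord one of them gives an \<open>E\<close> point and the other an \<open>F\<close> point
  (\<open>same_event_alternates\<close>). This is why all arcs are \<open>EF\<close> arcs when \<open>(*)\<close> fails.
\<close>

section \<open>Distributions and their conditional probabilities\<close>

definition mat2 :: "real \<Rightarrow> real \<Rightarrow> real \<Rightarrow> real \<Rightarrow> real^2^2" where
  "mat2 p q r s = vector [vector [p, q], vector [r, s]]"

lemma mat2_nth [simp]:
  "mat2 p q r s $ 1 $ 1 = p" "mat2 p q r s $ 1 $ 2 = q"
  "mat2 p q r s $ 2 $ 1 = r" "mat2 p q r s $ 2 $ 2 = s"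
  by (simp_all add: mat2_def)

lemma matrix2_eq_iff: "P = Q \<longleftrightarrow>
    P$1$1 = Q$1$1 \<and> P$1$2 = Q$1$2 \<and> P$2$1 = Q$2$1 \<and> P$2$2 = (Q$2$2 :: real)"
  for P Q :: "real^2^2"
  by (auto simp: vec_eq_iff forall_2)

lemma open_simplex_iff: "P \<in> open_simplex \<longleftrightarrow>
    0 < P$1$1 \<and> 0 < P$1$2 \<and> 0 < P$2$1 \<and> 0 < P$2$2 \<and> P$1$1 + P$1$2 + P$2$1 + P$2$2 = 1"
  by (auto simp: open_simplex_def forall_2 sum_2)

text \<open>
  Player 1's expected payoff from row 1 minus that from row 2, when the opponent plays column 1 with
  probability \<open>x\<close> in row 1 and \<open>y\<close> in row 2. Applied to the transposed payoff matrix of player 2 it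
  compares the two columns.
\<close>

definition payoff_gap :: "real^2^2 \<Rightarrow> real \<Rightarrow> real \<Rightarrow> real" where
  "payoff_gap a x y = x * a$1$1 + (1 - x) * a$1$2 - (y * a$2$1 + (1 - y) * a$2$2)"

lemma det_M1: "det (M1 X P) =
    (P$1$1 + P$1$2) * (fst X$2$1 * P$2$1 + fst X$2$2 * P$2$2)
    - (P$2$1 + P$2$2) * (fst X$1$1 * P$1$1 + fst X$1$2 * P$1$2)"
  by (simp add: M1_def Let_def det_2 algebra_simps)

lemma det_M2: "det (M2 X P) =
    (P$1$1 + P$2$1) * (snd X$1$2 * P$1$2 + snd X$2$2 * P$2$2)
    - (P$1$2 + P$2$2) * (snd X$1$1 * P$1$1 + snd X$2$1 * P$2$1)"
  by (simp add: M2_def Let_def det_2 algebra_simps)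

lemma det_M1_eq_payoff_gap:
  assumes "P$1$1 = x * r" "P$1$2 = (1 - x) * r" "P$2$1 = y * s" "P$2$2 = (1 - y) * s"
  shows "det (M1 X P) = - (r * s * payoff_gap (fst X) x y)"
  by (simp add: det_M1 assms payoff_gap_def algebra_simps)

lemma det_M2_eq_payoff_gap:
  assumes "P$1$1 = z * r" "P$2$1 = (1 - z) * r" "P$1$2 = w * s" "P$2$2 = (1 - w) * s"
  shows "det (M2 X P) = - (r * s * payoff_gap (transpose (snd X)) z w)"
  by (simp add: det_M2 assms payoff_gap_def transpose_def algebra_simps)

text \<open>
  The row totals \<open>r\<close>, \<open>s\<close> of a distribution with these conditional probabilities form the stationary
  distribution of the two-state chain that draws a column from the current row and then a row from that
  column; \<open>m\<close> and \<open>n\<close> are its transition probabilities into row 1 from row 2 and into row 2 from row 1. For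
  \<open>z, w \<in> [0, 1]\<close> this is continuous in all points \<open>(x, y)\<close> of the closed square other than its corners, which
  is what the ends of arcs need.
\<close>

definition joint :: "real \<Rightarrow> real \<Rightarrow> real \<Rightarrow> real \<Rightarrow> real^2^2" where
  "joint x y z w =
    (let m = z * y + w * (1 - y); n = (1 - z) * x + (1 - w) * (1 - x);
         r = m / (m + n); s = n / (m + n)
     in mat2 (x * r) ((1 - x) * r) (y * s) ((1 - y) * s))"

text \<open>
  The equation \<open>x (1 - y) / ((1 - x) y) = z (1 - w) / ((1 - z) w)\<close>, cleared of denominators so that it can
  be used on the boundary.
\<close>

definition same_odds :: "real \<Rightarrow> real \<Rightarrow> real \<Rightarrow> real \<Rightarrow> bool" where
  "same_odds x y z w \<longleftrightarrow> x * (1 - y) * ((1 - z) * w) = (1 - x) * y * (z * (1 - w))"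

lemma joint_denominator_pos:
  fixes x y z w :: real
  assumes "x \<in> {0..1}" "y \<in> {0..1}" "z \<in> {0..1}" "w \<in> {0..1}"
    and "x \<in> {0<..<1} \<or> y \<in> {0<..<1}"
  shows "0 < z * y + w * (1 - y) + ((1 - z) * x + (1 - w) * (1 - x))"
proof -
  have nn: "0 \<le> z * y" "0 \<le> w * (1 - y)" "0 \<le> (1 - z) * x" "0 \<le> (1 - w) * (1 - x)"
    using assms by auto
  have "z * y + w * (1 - y) + ((1 - z) * x + (1 - w) * (1 - x)) \<noteq> 0"
  proof
    assume "z * y + w * (1 - y) + ((1 - z) * x + (1 - w) * (1 - x)) = 0"
    then have "z * y = 0" "w * (1 - y) = 0" "(1 - z) * x = 0" "(1 - w) * (1 - x) = 0"
      using nn by linarith+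
    then show False using assms(5) by auto
  qed
  then show ?thesis using nn by linarith
qed

lemma joint_rows:
  assumes "m = z * y + w * (1 - y)" "n = (1 - z) * x + (1 - w) * (1 - x)"
  shows "joint x y z w $ 1 $ 1 = x * (m / (m + n))" "joint x y z w $ 1 $ 2 = (1 - x) * (m / (m + n))"
    "joint x y z w $ 2 $ 1 = y * (n / (m + n))" "joint x y z w $ 2 $ 2 = (1 - y) * (n / (m + n))"
  unfolding assms joint_def Let_def by simp_all

text \<open>
  The row conditionals are \<open>x\<close> and \<open>y\<close> by construction; equality of the odds ratios is what makes the
  column conditionals come out as \<open>z\<close> and \<open>w\<close>. The equations are stated without division because they are
  needed at boundary points, where a column may be zero.
\<close>

lemma joint_columns:
  assumes "same_odds x y z w"
  shows "joint x y z w $ 1 $ 1 = z * (joint x y z w $ 1 $ 1 + joint x y z w $ 2 $ 1)"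
    "joint x y z w $ 2 $ 1 = (1 - z) * (joint x y z w $ 1 $ 1 + joint x y z w $ 2 $ 1)"
    "joint x y z w $ 1 $ 2 = w * (joint x y z w $ 1 $ 2 + joint x y z w $ 2 $ 2)"
    "joint x y z w $ 2 $ 2 = (1 - w) * (joint x y z w $ 1 $ 2 + joint x y z w $ 2 $ 2)"
proof -
  define m where "m = z * y + w * (1 - y)"
  define n where "n = (1 - z) * x + (1 - w) * (1 - x)"
  note r = joint_rows[OF m_def n_def]
  have "(1 - z) * (x * m) = z * (y * n)" "(1 - w) * ((1 - x) * m) = w * ((1 - y) * n)"
    using assms by (simp_all add: same_odds_def m_def n_def algebra_simps)
  then have "(1 - z) * (x * m) / (m + n) = z * (y * n) / (m + n)"
    "(1 - w) * ((1 - x) * m) / (m + n) = w * ((1 - y) * n) / (m + n)" by simp_all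
  then have *: "(1 - z) * joint x y z w $ 1 $ 1 = z * joint x y z w $ 2 $ 1"
     "(1 - w) * joint x y z w $ 1 $ 2 = w * joint x y z w $ 2 $ 2"
    unfolding r by (simp_all add: mult.assoc)
  show "joint x y z w $ 1 $ 1 = z * (joint x y z w $ 1 $ 1 + joint x y z w $ 2 $ 1)"
    "joint x y z w $ 2 $ 1 = (1 - z) * (joint x y z w $ 1 $ 1 + joint x y z w $ 2 $ 1)"
    "joint x y z w $ 1 $ 2 = w * (joint x y z w $ 1 $ 2 + joint x y z w $ 2 $ 2)"
    "joint x y z w $ 2 $ 2 = (1 - w) * (joint x y z w $ 1 $ 2 + joint x y z w $ 2 $ 2)"
    using * by (simp_all add: algebra_simps)
qed

lemma joint_on_variety:
  assumes "same_odds x y z w" "payoff_gap (fst X) x y = 0" "payoff_gap (transpose (snd X)) z w = 0"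
  shows "det (M1 X (joint x y z w)) = 0" "det (M2 X (joint x y z w)) = 0"
  using det_M1_eq_payoff_gap[OF joint_rows[OF refl refl], of X x y z w]
    det_M2_eq_payoff_gap[OF joint_columns(1-4)[OF assms(1)], of X] assms by simp_all

lemma joint_sum:
  assumes "z * y + w * (1 - y) + ((1 - z) * x + (1 - w) * (1 - x)) \<noteq> 0"
  shows "joint x y z w $ 1 $ 1 + joint x y z w $ 1 $ 2 + joint x y z w $ 2 $ 1
    + joint x y z w $ 2 $ 2 = 1"
proof -
  define m where "m = z * y + w * (1 - y)"
  define n where "n = (1 - z) * x + (1 - w) * (1 - x)"
  have "m / (m + n) + n / (m + n) = 1"
    using assms by (simp add: m_def n_def add_divide_distrib[symmetric])
  moreover have "x * r + (1 - x) * r + y * s + (1 - y) * s = r + s" for r s :: real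
    by (simp add: algebra_simps)
  ultimately show ?thesis
    unfolding joint_rows[OF m_def n_def] by metis
qed

lemma joint_in_open_simplex:
  assumes "x \<in> {0<..<1}" "y \<in> {0<..<1}" "z \<in> {0<..<1}" "w \<in> {0<..<1}"
  shows "joint x y z w \<in> open_simplex"
proof -
  define m where "m = z * y + w * (1 - y)"
  define n where "n = (1 - z) * x + (1 - w) * (1 - x)"
  have "0 < m" "0 < n" using assms by (auto simp: m_def n_def intro!: add_pos_pos)
  then show ?thesis
    using assms joint_sum[of z y w x] unfolding open_simplex_iff
    unfolding joint_rows[OF m_def n_def] by (auto simp: m_def n_def)
qed

lemma joint_conditionals:
  assumes "x \<in> {0<..<1}" "y \<in> {0<..<1}" "z \<in> {0<..<1}" "w \<in> {0<..<1}" "same_odds x y z w"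
  defines "P \<equiv> joint x y z w"
  shows "P$1$1 / (P$1$1 + P$1$2) = x" "P$1$1 / (P$1$1 + P$2$1) = z"
proof -
  define m where "m = z * y + w * (1 - y)"
  define n where "n = (1 - z) * x + (1 - w) * (1 - x)"
  note r = joint_rows[OF m_def n_def, folded P_def]
  have "P \<in> open_simplex" unfolding P_def using joint_in_open_simplex assms(1-4) by simp
  then have pos: "P$1$1 + P$1$2 > 0" "P$1$1 + P$2$1 > 0" by (auto simp: open_simplex_iff)
  have "x * r = x * (x * r + (1 - x) * r)" for r :: real
    by (simp add: algebra_simps)
  then have "P$1$1 = x * (P$1$1 + P$1$2)" unfolding r by blast
  then show "P$1$1 / (P$1$1 + P$1$2) = x" using pos by (simp add: divide_eq_eq)
  show "P$1$1 / (P$1$1 + P$2$1) = z"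
    using joint_columns(1)[OF assms(5)] pos unfolding P_def by (simp add: divide_eq_eq)
qed

lemma open_simplex_eq_joint:
  assumes P: "P \<in> open_simplex"
  obtains x y z w where "x \<in> {0<..<1}" "y \<in> {0<..<1}" "z \<in> {0<..<1}" "w \<in> {0<..<1}"
    "same_odds x y z w" "P = joint x y z w"
proof -
  define p q r s where "p = P$1$1" and "q = P$1$2" and "r = P$2$1" and "s = P$2$2"
  have pos: "0 < p" "0 < q" "0 < r" "0 < s" and sum: "p + q + r + s = 1"
    using P by (auto simp: open_simplex_iff p_def q_def r_def s_def)
  define x y z w where "x = p / (p + q)" and "y = r / (r + s)" and "z = p / (p + r)" and "w = q / (q + s)"
  have c: "1 - x = q / (p + q)" "1 - y = s / (r + s)" "1 - z = r / (p + r)" "1 - w = s / (q + s)"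
    using pos by (auto simp: x_def y_def z_def w_def field_simps)
  have odds: "same_odds x y z w"
    unfolding same_odds_def c by (simp add: x_def y_def z_def w_def mult_ac)
  define m n where "m = z * y + w * (1 - y)" and "n = (1 - z) * x + (1 - w) * (1 - x)"
  have "y * (r + s) = r" "(1 - y) * (r + s) = s" "x * (p + q) = p" "(1 - x) * (p + q) = q"
    using pos unfolding c by (simp_all add: x_def y_def)
  moreover have "m * (r + s) = z * (y * (r + s)) + w * ((1 - y) * (r + s))"
    "n * (p + q) = (1 - z) * (x * (p + q)) + (1 - w) * ((1 - x) * (p + q))"
    by (simp_all add: m_def n_def algebra_simps)
  ultimately have "m * (r + s) = z * r + w * s" "n * (p + q) = (1 - z) * p + (1 - w) * q"
    by simp_all
  moreover have "z * r = p * (1 - z)" "w * s = q * (1 - w)"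
    unfolding c by (simp_all add: z_def w_def)
  ultimately have mn: "m * (r + s) = n * (p + q)"
    by (simp add: mult.commute)
  have "0 < z * y" "0 < w * (1 - y)" "0 < (1 - z) * x" "0 < (1 - w) * (1 - x)" using pos
    unfolding c by (simp_all add: x_def y_def z_def w_def)
  then have "0 < m" "0 < n"
    by (auto simp: m_def n_def)
  \<comment> \<open>The row totals are stationary, and their sum is 1, so they are the normalized pair \<open>(m, n)\<close>.\<close>
  have "m = (m + n) * (p + q)" "n = (m + n) * (r + s)"
  proof -
    have 1: "p + q = 1 - (r + s)" using sum by simp
    show "m = (m + n) * (p + q)" using mn unfolding 1 by (simp add: algebra_simps)
    have 2: "r + s = 1 - (p + q)" using sum by simp
    show "n = (m + n) * (r + s)" using mn unfolding 2 by (simp add: algebra_simps)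
  qed
  then have mn: "m / (m + n) = p + q" "n / (m + n) = r + s"
    using \<open>0 < m\<close> \<open>0 < n\<close> by (simp_all add: divide_eq_eq mult.commute)
  have "P = joint x y z w"
    unfolding matrix2_eq_iff joint_rows[OF m_def n_def] mn
    using pos unfolding c by (simp add: x_def y_def flip: p_def q_def r_def s_def)
  moreover have "x \<in> {0<..<1}" "y \<in> {0<..<1}" "z \<in> {0<..<1}" "w \<in> {0<..<1}"
    using pos by (auto simp: x_def y_def z_def w_def)
  ultimately show ?thesis using that odds by blast
qed

text \<open>
  On the open simplex the determinants are nonzero multiples of the payoff gaps, so in the conditional
  probabilities the curve is cut out by two linear equations and the equality of the odds ratios.
\<close>

lemma dependency_equilibria_iff:
  "P \<in> dependency_equilibria X \<longleftrightarrow> (\<exists>x y z w. x \<in> {0<..<1} \<and> y \<in> {0<..<1} \<and> z \<in> {0<..<1} \<and> w \<in> {0<..<1}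
     \<and> same_odds x y z w \<and> payoff_gap (fst X) x y = 0 \<and> payoff_gap (transpose (snd X)) z w = 0
     \<and> P = joint x y z w)" (is "?l \<longleftrightarrow> ?r")
proof
  assume ?l
  then have P: "P \<in> open_simplex" and "span {P} \<in> spohn_variety X"
    by (auto simp: dependency_equilibria_def)
  moreover have "P \<noteq> 0" using P by (auto simp: open_simplex_iff)
  ultimately have d: "det (M1 X P) = 0" "det (M2 X P) = 0"
    using span_in_spohn_variety_iff by blast+
  obtain x y z w where xyzw: "x \<in> {0<..<1}" "y \<in> {0<..<1}" "z \<in> {0<..<1}" "w \<in> {0<..<1}"
    "same_odds x y z w" "P = joint x y z w" using open_simplex_eq_joint[OF P] .
  define m n where "m = z * y + w * (1 - y)" and "n = (1 - z) * x + (1 - w) * (1 - x)"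
  have "0 < m" "0 < n" using xyzw(1-4) by (auto simp: m_def n_def intro!: add_pos_pos)
  then have "payoff_gap (fst X) x y = 0"
    using det_M1_eq_payoff_gap[OF joint_rows[OF m_def n_def], of X] d(1)
    unfolding xyzw(6) by simp
  moreover have "payoff_gap (transpose (snd X)) z w = 0"
    using det_M2_eq_payoff_gap[OF joint_columns(1-4)[OF xyzw(5)], of X] d(2) P
    unfolding xyzw(6)[symmetric] by (auto simp: open_simplex_iff)
  ultimately show ?r using xyzw by blast
next
  assume ?r
  then obtain x y z w where *: "x \<in> {0<..<1}" "y \<in> {0<..<1}" "z \<in> {0<..<1}" "w \<in> {0<..<1}"
     "same_odds x y z w" "payoff_gap (fst X) x y = 0" "payoff_gap (transpose (snd X)) z w = 0"
     "P = joint x y z w" by blast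
  have "P \<in> open_simplex" using joint_in_open_simplex *(1-4,8) by simp
  moreover from this have "P \<noteq> 0" by (auto simp: open_simplex_iff)
  ultimately show ?l
    using joint_on_variety[OF *(5-7)] *(8) span_in_spohn_variety_iff
    by (simp add: dependency_equilibria_def)
qed

lemma continuous_on_joint:
  fixes x y z w :: "'a::topological_space \<Rightarrow> real"
  assumes [continuous_intros]: "continuous_on S x" "continuous_on S y" "continuous_on S z" "continuous_on S w"
   and "\<And>t. t \<in> S \<Longrightarrow> z t * y t + w t * (1 - y t) + ((1 - z t) * x t + (1 - w t) * (1 - x t)) \<noteq> 0"
  shows "continuous_on S (\<lambda>t. joint (x t) (y t) (z t) (w t))"
proof -
  have "continuous_on S (\<lambda>t. joint (x t) (y t) (z t) (w t) $ 1 $ 1)"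
    "continuous_on S (\<lambda>t. joint (x t) (y t) (z t) (w t) $ 1 $ 2)"
    "continuous_on S (\<lambda>t. joint (x t) (y t) (z t) (w t) $ 2 $ 1)"
    "continuous_on S (\<lambda>t. joint (x t) (y t) (z t) (w t) $ 2 $ 2)"
    by (simp_all only: joint_rows[OF refl refl]) (auto intro!: continuous_intros assms(5))
  then have "continuous_on S (\<lambda>t. joint (x t) (y t) (z t) (w t) $ i $ j)" for i j
    using exhaust_2[of i] exhaust_2[of j] by auto
  then have "continuous_on S (\<lambda>t. \<chi> i j. joint (x t) (y t) (z t) (w t) $ i $ j)"
    by (intro continuous_on_vec_lambda)
  then show ?thesis by (simp add: vec_lambda_eta)
qed

section \<open>The odds ratio along a chord of the unit square\<close>

text \<open>
  If \<open>k\<close> is the odds ratio, this is \<open>k / (1 + k)\<close>: the values 0 and \<open>\<infinity>\<close> of the odds ratio, which occur on the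
  sides of the square, become 0 and 1.
\<close>

definition odds_share :: "real \<Rightarrow> real \<Rightarrow> real" where
  "odds_share x y = x * (1 - y) / (x * (1 - y) + (1 - x) * y)"

definition on_side :: "real \<Rightarrow> real \<Rightarrow> bool" where
  "on_side x y \<longleftrightarrow> x \<in> {0, 1} \<and> y \<in> {0<..<1} \<or> y \<in> {0, 1} \<and> x \<in> {0<..<1}"

text \<open>
  Segments are parametrized by \<open>[0, 1]\<close> coordinate by coordinate, so that \<open>x\<close> and \<open>y\<close> are affine and
  \<open>x (1 - y)\<close> and \<open>(1 - x) y\<close> are quadratic in the parameter.
\<close>

definition along :: "real \<Rightarrow> real \<Rightarrow> real \<Rightarrow> real" where
  "along u v t = (1 - t) * u + t * v"

definition chord :: "real \<Rightarrow> real \<Rightarrow> real \<Rightarrow> real \<Rightarrow> bool" where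
  "chord x0 y0 x1 y1 \<longleftrightarrow> on_side x0 y0 \<and> on_side x1 y1 \<and> x0 \<noteq> x1 \<and> y0 \<noteq> y1"

lemma along_ends [simp]: "along u v 0 = u" "along u v 1 = v"
  by (simp_all add: along_def)

lemma continuous_on_along [continuous_intros]: "continuous_on S (along u v)"
  unfolding along_def by (intro continuous_intros)

lemma along_in_open:
  assumes "u \<in> {0..1}" "v \<in> {0..1}" "u \<noteq> v" "t \<in> {0<..<1}"
  shows "along u v t \<in> {0<..<1}"
proof (cases "u < v")
  case True
  then have "0 < t * (v - u)" "t * (v - u) < v - u" using assms by auto
  moreover have "along u v t = u + t * (v - u)" by (simp add: along_def algebra_simps)
  ultimately show ?thesis using assms by simp
next
  case False
  then have "0 < t * (u - v)" "t * (u - v) < u - v" using assms by auto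
  moreover have "along u v t = u - t * (u - v)" by (simp add: along_def algebra_simps)
  ultimately show ?thesis using assms by simp
qed

lemma chord_interior:
  assumes "chord x0 y0 x1 y1" "t \<in> {0<..<1}"
  shows "along x0 x1 t \<in> {0<..<1}" "along y0 y1 t \<in> {0<..<1}"
proof -
  have "x0 \<in> {0..1}" "x1 \<in> {0..1}" "y0 \<in> {0..1}" "y1 \<in> {0..1}" "x0 \<noteq> x1" "y0 \<noteq> y1"
    using assms(1) by (auto simp: chord_def on_side_def)
  then show "along x0 x1 t \<in> {0<..<1}" "along y0 y1 t \<in> {0<..<1}"
    using along_in_open assms(2) by blast+
qed

lemma chord_closed:
  assumes "chord x0 y0 x1 y1" "t \<in> {0..1}"
  shows "along x0 x1 t \<in> {0..1}" "along y0 y1 t \<in> {0..1}"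
    "along x0 x1 t \<in> {0<..<1} \<or> along y0 y1 t \<in> {0<..<1}"
proof -
  have "t = 0 \<or> t = 1 \<or> t \<in> {0<..<1}" using assms(2) by auto
  then have "along x0 x1 t \<in> {0..1} \<and> along y0 y1 t \<in> {0..1} \<and>
      (along x0 x1 t \<in> {0<..<1} \<or> along y0 y1 t \<in> {0<..<1})"
  proof (elim disjE)
    assume "t \<in> {0<..<1}"
    then show ?thesis using chord_interior[OF assms(1)] by fastforce
  qed (use assms(1) in \<open>auto simp: chord_def on_side_def\<close>)
  then show "along x0 x1 t \<in> {0..1}" "along y0 y1 t \<in> {0..1}"
    "along x0 x1 t \<in> {0<..<1} \<or> along y0 y1 t \<in> {0<..<1}" by auto
qed

text \<open>
  Of the four corners of the square, only \<open>(0, 0)\<close> and \<open>(1, 1)\<close> make both odds products vanish.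
\<close>

lemma odds_denominator_pos:
  fixes x y :: real
  assumes "x \<in> {0..1}" "y \<in> {0..1}" "x \<in> {0<..<1} \<or> y \<in> {0<..<1}"
  shows "0 < x * (1 - y) + (1 - x) * y"
  using assms(3)
proof
  assume x: "x \<in> {0<..<1}"
  show ?thesis
  proof (cases "y = 0")
    case False
    then have "0 < (1 - x) * y" "0 \<le> x * (1 - y)" using x assms by auto
    then show ?thesis by linarith
  qed (use x in auto)
next
  assume y: "y \<in> {0<..<1}"
  show ?thesis
  proof (cases "x = 0")
    case False
    then have "0 < x * (1 - y)" "0 \<le> (1 - x) * y" using y assms by auto
    then show ?thesis by linarith
  qed (use y in auto)
qed

lemma odds_share_interior:
  assumes "x \<in> {0<..<1}" "y \<in> {0<..<1}"
  shows "odds_share x y \<in> {0<..<1}"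
proof -
  have "0 < x * (1 - y)" "0 < (1 - x) * y" using assms by auto
  then show ?thesis unfolding odds_share_def by (auto simp: field_simps)
qed

lemma odds_share_side:
  assumes "on_side x y"
  shows "odds_share x y = (if x = 0 \<or> y = 1 then 0 else 1)"
  using assms by (auto simp: on_side_def odds_share_def)

lemma same_odds_iff_odds_share:
  assumes "0 < x * (1 - y) + (1 - x) * y" "0 < z * (1 - w) + (1 - z) * w"
  shows "same_odds x y z w \<longleftrightarrow> odds_share x y = odds_share z w"
  unfolding odds_share_def same_odds_def using assms
  by (simp add: frac_eq_eq algebra_simps)

text \<open>
  For quadratic \<open>a\<close> and \<open>b\<close> the difference \<open>a s * b t - a t * b s\<close> is divisible by \<open>s - t\<close>. The quotient \<open>W\<close> is
  symmetric and affine in each variable, so its sign on a square can be read off from few values.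
\<close>

lemma fraction_injI:
  fixes a b :: "real \<Rightarrow> real"
  assumes pos: "\<And>t. t \<in> S \<Longrightarrow> 0 < a t + b t"
    and W: "\<And>s t. s \<in> S \<Longrightarrow> t \<in> S \<Longrightarrow> a s * b t - a t * b s = (s - t) * W s t"
    and nz: "\<And>s t. s \<in> S \<Longrightarrow> t \<in> S \<Longrightarrow> s < t \<Longrightarrow> W s t \<noteq> 0"
  shows "inj_on (\<lambda>t. a t / (a t + b t)) S"
proof (rule linorder_inj_onI')
  fix s t assume st: "s \<in> S" "t \<in> S" "s < t"
  show "a s / (a s + b s) \<noteq> a t / (a t + b t)"
  proof
    assume "a s / (a s + b s) = a t / (a t + b t)"
    then have "a s * (a t + b t) = a t * (a s + b s)"
      using pos[OF st(1)] pos[OF st(2)] by (simp add: frac_eq_eq)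
    then have "a s * b t - a t * b s = 0" by (simp add: algebra_simps)
    then show False using W nz st by auto
  qed
qed

text \<open>
  Here \<open>a\<close> vanishes at 0 and \<open>b\<close> vanishes at 1, so the quotient runs from 0 to 1. The symmetric function
  \<open>W\<close> that is affine in both variables is positive at all corners of the unit square, hence on all of it.
\<close>

lemma crossing_inj:
  fixes a b :: "real \<Rightarrow> real"
  assumes a: "\<And>t. a t = t * (a1 + a2 * t)" and b: "\<And>t. b t = (1 - t) * (b1 + b2 * (1 - t))"
    and pos: "\<And>t. t \<in> {0..1} \<Longrightarrow> 0 < a t + b t"
    and "0 < a1" "0 < b1" "0 < a 1" "0 < b 0"
  shows "inj_on (\<lambda>t. a t / (a t + b t)) {0..1}"
proof (rule fraction_injI[where W = "\<lambda>s t. a1 * b 0 * ((1 - s) * (1 - t))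
      + a 1 * b 0 * (s * (1 - t) + t * (1 - s)) + b1 * a 1 * (s * t)"])
  fix s t :: real assume "s \<in> {0..1}" "t \<in> {0..1}" "s < t"
  then have "0 \<le> s" "s < 1" "0 < t" "t \<le> 1" by auto
  then have "0 \<le> (1 - s) * (1 - t)" "0 < s * (1 - t) + t * (1 - s)" "0 \<le> s * t"
    by (auto intro!: add_nonneg_pos)
  moreover have "0 < a1 * b 0" "0 < a 1 * b 0" "0 < b1 * a 1" using assms by auto
  ultimately have "0 \<le> a1 * b 0 * ((1 - s) * (1 - t))"
      "0 < a 1 * b 0 * (s * (1 - t) + t * (1 - s))" "0 \<le> b1 * a 1 * (s * t)"
    by (smt (verit) mult_nonneg_nonneg mult_pos_pos)+
  then show "a1 * b 0 * ((1 - s) * (1 - t))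
      + a 1 * b 0 * (s * (1 - t) + t * (1 - s)) + b1 * a 1 * (s * t) \<noteq> 0"
    by linarith
next
  fix s t :: real
  show "a s * b t - a t * b s = (s - t) * (a1 * b 0 * ((1 - s) * (1 - t))
      + a 1 * b 0 * (s * (1 - t) + t * (1 - s)) + b1 * a 1 * (s * t))"
    unfolding a b by (simp add: algebra_simps power2_eq_square)
qed (use pos in auto)

text \<open>
  Here \<open>\<alpha> t (1 - t)\<close> vanishes at both ends. Then \<open>W s t\<close> is a multiple of
  \<open>b 0 (1 - s) (1 - t) - b 1 s t\<close>: two different parameters have the same value iff the product of
  their odds \<open>s / (1 - s)\<close> and \<open>t / (1 - t)\<close> is \<open>b 0 / b 1\<close>. The fixed point \<open>c\<close> of this involution has the odds
  \<open>sqrt (b 0 / b 1)\<close>. No orbit has two points on the same side of \<open>c\<close>. The last equation says that the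
  derivative of the quotient vanishes at \<open>c\<close>.
\<close>

lemma fold_inj:
  fixes b :: "real \<Rightarrow> real"
  assumes b: "\<And>t. b t = b0 + b1 * t + b2 * t^2"
    and "0 < \<alpha>" "0 < b 0" "0 < b 1"
    and pos: "\<And>t. t \<in> {0..1} \<Longrightarrow> 0 < \<alpha> * (t * (1 - t)) + b t"
  defines "h \<equiv> (\<lambda>t. \<alpha> * (t * (1 - t)) / (\<alpha> * (t * (1 - t)) + b t))"
  obtains c where "c \<in> {0<..<1}" "inj_on h {0..c}" "inj_on h {c..1}"
    "(1 - 2 * c) * b c = c * (1 - c) * (b1 + 2 * b2 * c)"
proof -
  define c where "c = sqrt (b 0) / (sqrt (b 0) + sqrt (b 1))"
  have sq: "0 < sqrt (b 0)" "0 < sqrt (b 1)" using assms by auto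
  then have c: "c \<in> {0<..<1}"
    unfolding c_def by (simp add: add_pos_pos)
  have "1 - c = sqrt (b 1) / (sqrt (b 0) + sqrt (b 1))"
    using add_pos_pos[OF sq] by (simp add: c_def diff_divide_eq_iff)
  then have "sqrt (b 0) * (1 - c) = sqrt (b 1) * c"
    by (simp add: c_def)
  then have "(sqrt (b 0) * (1 - c))\<^sup>2 = (sqrt (b 1) * c)\<^sup>2" by simp
  then have crit: "b 0 * (1 - c)\<^sup>2 = b 1 * c\<^sup>2"
    using assms by (simp add: power_mult_distrib)
  have W: "\<alpha> * (s * (1 - s)) * b t - \<alpha> * (t * (1 - t)) * b s
      = (s - t) * (\<alpha> * (b 0 * ((1 - s) * (1 - t)) - b 1 * (s * t)))" for s t
    unfolding b by (simp add: algebra_simps power2_eq_square)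
  have "inj_on h {0..c}" unfolding h_def
  proof (rule fraction_injI[OF _ W])
    fix s t assume st: "s \<in> {0..c}" "t \<in> {0..c}" "s < t"
    then have "(1 - c) * (1 - c) < (1 - s) * (1 - t)" "s * t \<le> c * c"
      using c by (auto intro!: mult_mono mult_less_le_imp_less)
    then have "b 0 * ((1 - c) * (1 - c)) < b 0 * ((1 - s) * (1 - t))" "b 1 * (s * t) \<le> b 1 * (c * c)"
      using assms by (simp_all)
    then have "b 1 * (s * t) < b 0 * ((1 - s) * (1 - t))"
      using crit by (simp add: power2_eq_square)
    then show "\<alpha> * (b 0 * ((1 - s) * (1 - t)) - b 1 * (s * t)) \<noteq> 0"
      using \<open>0 < \<alpha>\<close> by simp
  qed (use pos c in auto)
  moreover have "inj_on h {c..1}" unfolding h_def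
  proof (rule fraction_injI[OF _ W])
    fix s t assume st: "s \<in> {c..1}" "t \<in> {c..1}" "s < t"
    then have "(1 - s) * (1 - t) \<le> (1 - c) * (1 - c)" "c * c < s * t"
      using c by (auto intro!: mult_mono mult_le_less_imp_less)
    then have "b 0 * ((1 - s) * (1 - t)) \<le> b 0 * ((1 - c) * (1 - c))" "b 1 * (c * c) < b 1 * (s * t)"
      using assms by (simp_all)
    then have "b 0 * ((1 - s) * (1 - t)) < b 1 * (s * t)"
      using crit by (simp add: power2_eq_square)
    then show "\<alpha> * (b 0 * ((1 - s) * (1 - t)) - b 1 * (s * t)) \<noteq> 0"
      using \<open>0 < \<alpha>\<close> by simp
  qed (use pos c in auto)
  moreover have "(1 - 2 * c) * b c = c * (1 - c) * (b1 + 2 * b2 * c)"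
    using crit unfolding b by (simp add: algebra_simps power2_eq_square power3_eq_cube)
  ultimately show ?thesis using that c by blast
qed

definition chord_share :: "real \<Rightarrow> real \<Rightarrow> real \<Rightarrow> real \<Rightarrow> real \<Rightarrow> real" where
  "chord_share x0 y0 x1 y1 t = odds_share (along x0 x1 t) (along y0 y1 t)"

text \<open>
  The two odds products are quadratic along the chord and have simple zeros at its ends, because a chord
  meets a side of the square transversally.
\<close>

lemma chord_share_crossing:
  assumes "chord x0 y0 x1 y1" "x0 = 0 \<or> y0 = 1" "\<not> (x1 = 0 \<or> y1 = 1)"
  shows "inj_on (chord_share x0 y0 x1 y1) {0..1}"
proof -
  define a where "a = (\<lambda>t. along x0 x1 t * (1 - along y0 y1 t))"
  define b where "b = (\<lambda>t. (1 - along x0 x1 t) * along y0 y1 t)"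
  have s: "x0 \<in> {0..1}" "x1 \<in> {0..1}" "y0 \<in> {0..1}" "y1 \<in> {0..1}" "x0 \<noteq> x1" "y0 \<noteq> y1"
      "on_side x0 y0" "on_side x1 y1"
    using assms(1) by (auto simp: chord_def on_side_def)
  have a0: "x0 * (1 - y0) = 0" and b1: "(1 - x1) * y1 = 0"
    using assms(2,3) s(8) by (auto simp: on_side_def)
  define dx dy where "dx = x1 - x0" and "dy = y1 - y0"
  have along: "along x0 x1 t = x0 + dx * t" "along y0 y1 t = y0 + dy * t"
    "along x0 x1 t = x1 - dx * (1 - t)" "along y0 y1 t = y1 - dy * (1 - t)" for t
    by (simp_all add: along_def dx_def dy_def algebra_simps)
  have "inj_on (\<lambda>t. a t / (a t + b t)) {0..1}"
  proof (rule crossing_inj)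
    show "a t = t * ((dx * (1 - y0) - x0 * dy) + (- dx * dy) * t)" for t
      unfolding a_def along(1,2) using a0 by (simp add: algebra_simps)
    show "b t = (1 - t) * ((dx * y1 - (1 - x1) * dy) + (- dx * dy) * (1 - t))" for t
      unfolding b_def along(3,4) using b1 by (simp add: algebra_simps)
    show "0 < dx * (1 - y0) - x0 * dy"
      using s assms(2) by (auto simp: dx_def dy_def on_side_def mult_pos_neg)
    show "0 < dx * y1 - (1 - x1) * dy"
      using s assms(3) by (auto simp: dx_def dy_def on_side_def mult_pos_neg)
    show "0 < a 1" "0 < b 0"
      using s assms(2,3) by (auto simp: a_def b_def on_side_def)
    show "0 < a t + b t" if "t \<in> {0..1}" for t
      using odds_denominator_pos[OF chord_closed[OF assms(1) that]] by (simp add: a_def b_def)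
  qed
  then show ?thesis by (simp add: a_def b_def odds_share_def chord_share_def[abs_def])
qed

text \<open>
  Exchanging \<open>x\<close> and \<open>y\<close> inverts the odds ratio. This reduces chords that end where the share is 1 to chords
  that end where it is 0.
\<close>

lemma odds_share_swap:
  assumes "0 < x * (1 - y) + (1 - x) * y"
  shows "odds_share y x = 1 - odds_share x y"
  using assms by (simp add: odds_share_def field_simps)

lemma chord_swap: "chord x0 y0 x1 y1 \<longleftrightarrow> chord y0 x0 y1 x1"
  by (auto simp: chord_def on_side_def)

lemma chord_reverse: "chord x0 y0 x1 y1 \<longleftrightarrow> chord x1 y1 x0 y0"
  by (auto simp: chord_def)

lemma chord_share_swap:
  assumes "chord x0 y0 x1 y1" "t \<in> {0..1}"
  shows "chord_share y0 x0 y1 x1 t = 1 - chord_share x0 y0 x1 y1 t"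
  using odds_denominator_pos[OF chord_closed[OF assms]] odds_share_swap
  unfolding chord_share_def by blast

lemma chord_share_interior:
  assumes "chord x0 y0 x1 y1" "t \<in> {0<..<1}"
  shows "chord_share x0 y0 x1 y1 t \<in> {0<..<1}"
  using chord_interior[OF assms] odds_share_interior unfolding chord_share_def by blast

lemma continuous_on_chord_share:
  assumes "chord x0 y0 x1 y1"
  shows "continuous_on {0..1} (chord_share x0 y0 x1 y1)"
  unfolding odds_share_def chord_share_def[abs_def]
proof (intro continuous_intros ballI)
  fix t :: real assume "t \<in> {0..1}"
  from odds_denominator_pos[OF chord_closed[OF assms this]]
  show "along x0 x1 t * (1 - along y0 y1 t) + (1 - along x0 x1 t) * along y0 y1 t \<noteq> 0" by simp
qed

lemma chord_share_inj:
  assumes "chord x0 y0 x1 y1" "odds_share x0 y0 \<noteq> odds_share x1 y1"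
  shows "inj_on (chord_share x0 y0 x1 y1) {0..1}"
proof (cases "x0 = 0 \<or> y0 = 1")
  case True
  then show ?thesis
    using assms odds_share_side[of x0 y0] odds_share_side[of x1 y1] chord_share_crossing
    by (auto simp: chord_def split: if_splits)
next
  case False
  then have "y0 = 0 \<or> x0 = 1" "\<not> (y1 = 0 \<or> x1 = 1)"
    using assms odds_share_side[of x0 y0] odds_share_side[of x1 y1]
    by (auto simp: chord_def on_side_def split: if_splits)
  then have "inj_on (chord_share y0 x0 y1 x1) {0..1}"
    using chord_share_crossing assms(1) chord_swap by blast
  then show ?thesis using chord_share_swap[OF assms(1)]
    unfolding inj_on_def by simp
qed

text \<open>
  The derivative of the odds ratio in the direction \<open>(dx, dy)\<close> vanishes: the two products
  \<open>x (1 - y)\<close> and \<open>(1 - x) y\<close> have the same logarithmic derivative, cleared of denominators.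
\<close>

definition extremal_on :: "real \<Rightarrow> real \<Rightarrow> real \<Rightarrow> real \<Rightarrow> bool" where
  "extremal_on dx dy x y \<longleftrightarrow>
     (dx * (1 - y) - x * dy) * ((1 - x) * y) = x * (1 - y) * ((1 - x) * dy - dx * y)"

definition folds_at :: "real \<Rightarrow> real \<Rightarrow> real \<Rightarrow> real \<Rightarrow> real \<Rightarrow> bool" where
  "folds_at x0 y0 x1 y1 c \<longleftrightarrow> c \<in> {0<..<1} \<and>
     inj_on (chord_share x0 y0 x1 y1) {0..c} \<and> inj_on (chord_share x0 y0 x1 y1) {c..1} \<and>
     extremal_on (x1 - x0) (y1 - y0) (along x0 x1 c) (along y0 y1 c)"

lemma folds_at_swap:
  assumes ch: "chord x0 y0 x1 y1" and "folds_at y0 x0 y1 x1 c"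
  shows "folds_at x0 y0 x1 y1 c"
proof -
  have c: "c \<in> {0<..<1}" using assms(2) by (simp add: folds_at_def)
  have inj: "inj_on (chord_share x0 y0 x1 y1) {u..v}"
    if "inj_on (chord_share y0 x0 y1 x1) {u..v}" "{u..v} \<subseteq> {0..1}" for u v
  proof (rule inj_onI)
    fix s t assume st: "s \<in> {u..v}" "t \<in> {u..v}" "chord_share x0 y0 x1 y1 s = chord_share x0 y0 x1 y1 t"
    then have "chord_share y0 x0 y1 x1 s = chord_share y0 x0 y1 x1 t"
      using chord_share_swap[OF ch, of s] chord_share_swap[OF ch, of t] that(2) by (simp add: subset_iff)
    then show "s = t" using inj_onD[OF that(1)] st by blast
  qed
  have "extremal_on (x1 - x0) (y1 - y0) (along x0 x1 c) (along y0 y1 c)"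
    using assms(2) by (simp add: folds_at_def extremal_on_def algebra_simps)
  then show ?thesis using assms(2) inj[of 0 c] inj[of c 1] c unfolding folds_at_def by simp
qed

lemma along_reverse: "along u v (1 - t) = along v u t"
  by (simp add: along_def)

lemma folds_at_reverse:
  assumes "folds_at x1 y1 x0 y0 c"
  shows "folds_at x0 y0 x1 y1 (1 - c)"
proof -
  have rev: "chord_share x1 y1 x0 y0 (1 - t) = chord_share x0 y0 x1 y1 t" for t
    by (simp add: chord_share_def along_reverse)
  have inj: "inj_on (chord_share x0 y0 x1 y1) {1 - v..1 - u}"
    if "inj_on (chord_share x1 y1 x0 y0) {u..v}" for u v
  proof (rule inj_onI)
    fix s t assume "s \<in> {1 - v..1 - u}" "t \<in> {1 - v..1 - u}"
      "chord_share x0 y0 x1 y1 s = chord_share x0 y0 x1 y1 t"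
    then show "s = t" using inj_onD[OF that, of "1 - s" "1 - t"] by (auto simp: rev)
  qed
  have "extremal_on (x1 - x0) (y1 - y0) (along x0 x1 (1 - c)) (along y0 y1 (1 - c))"
    using assms unfolding along_reverse folds_at_def by (simp add: extremal_on_def algebra_simps)
  then show ?thesis using assms inj[of 0 c] inj[of c 1] unfolding folds_at_def by simp
qed

lemma chord_share_fold0:
  assumes ch: "chord x0 y0 x1 y1" and "x0 = 0" "y1 = 1"
  shows "\<exists>c. folds_at x0 y0 x1 y1 c"
proof -
  have s: "x1 \<in> {0<..<1}" "y0 \<in> {0<..<1}"
    using assms by (auto simp: chord_def on_side_def)
  define b where "b = (\<lambda>t. (1 - x1 * t) * (y0 + (1 - y0) * t))"
  have a: "along x0 x1 t * (1 - along y0 y1 t) = x1 * (1 - y0) * (t * (1 - t))" for t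
    using assms by (simp add: along_def algebra_simps)
  have b: "(1 - along x0 x1 t) * along y0 y1 t = b t" for t
    using assms by (simp add: along_def b_def algebra_simps)
  define \<alpha> where "\<alpha> = x1 * (1 - y0)"
  have [simp]: "0 < \<alpha>" "0 < b 0" "0 < b 1" using s by (auto simp: \<alpha>_def b_def)
  have pos: "0 < \<alpha> * (t * (1 - t)) + b t" if "t \<in> {0..1}" for t
    using odds_denominator_pos[OF chord_closed[OF ch that]] unfolding a b \<alpha>_def .
  have bq: "b t = y0 + (1 - y0 - x1 * y0) * t + (- x1 * (1 - y0)) * t\<^sup>2" for t
    by (simp add: b_def algebra_simps power2_eq_square)
  have share: "(chord_share x0 y0 x1 y1)
      = (\<lambda>t. \<alpha> * (t * (1 - t)) / (\<alpha> * (t * (1 - t)) + b t))"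
    unfolding chord_share_def[abs_def] odds_share_def a b \<alpha>_def ..
  obtain c where c: "c \<in> {0<..<1}"
    "inj_on (chord_share x0 y0 x1 y1) {0..c}"
    "inj_on (chord_share x0 y0 x1 y1) {c..1}"
    and crit: "(1 - 2 * c) * b c = c * (1 - c) * ((1 - y0 - x1 * y0) + 2 * (- x1 * (1 - y0)) * c)"
    unfolding share using fold_inj[OF bq _ _ _ pos] by auto
  have dx: "x1 - x0 = x1" "y1 - y0 = 1 - y0" using assms by auto
  have "extremal_on (x1 - x0) (y1 - y0) (along x0 x1 c) (along y0 y1 c)"
  proof -
    have "(x1 * (1 - along y0 y1 c) - along x0 x1 c * (1 - y0)) = \<alpha> * (1 - 2 * c)"
      using assms by (simp add: along_def \<alpha>_def algebra_simps)
    moreover have "(1 - along x0 x1 c) * (1 - y0) - x1 * along y0 y1 c =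
        (1 - y0 - x1 * y0) + 2 * (- x1 * (1 - y0)) * c"
      using assms by (simp add: along_def algebra_simps)
    ultimately show ?thesis
      unfolding extremal_on_def a b dx using crit by (simp add: \<alpha>_def)
  qed
  with c show ?thesis by (auto simp: folds_at_def)
qed

text \<open>
  Up to reversing the chord and exchanging the coordinates, a chord with equal values at its ends runs from
  the side \<open>x = 0\<close> to the side \<open>y = 1\<close>.
\<close>

lemma chord_share_fold:
  assumes ch: "chord x0 y0 x1 y1" and eq: "odds_share x0 y0 = odds_share x1 y1"
  shows "\<exists>c. folds_at x0 y0 x1 y1 c"
proof -
  have side: "on_side x0 y0" "on_side x1 y1" "x0 \<noteq> x1" "y0 \<noteq> y1"
    using ch by (auto simp: chord_def)
  consider "x0 = 0" "y1 = 1" | "x1 = 0" "y0 = 1" | "y0 = 0" "x1 = 1" | "y1 = 0" "x0 = 1"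
    using eq side unfolding odds_share_side[OF side(1)] odds_share_side[OF side(2)]
    by (auto simp: on_side_def split: if_splits)
  then show ?thesis
    by cases (metis chord_share_fold0 folds_at_swap folds_at_reverse ch chord_swap chord_reverse)+
qed

text \<open>
  A chord between the sides \<open>x = 0\<close> and \<open>y = 1\<close> cuts off the corner \<open>(0, 1)\<close>. It lies strictly above the
  diagonal \<open>x = y\<close>, on which the odds ratio is 1. Likewise a chord around \<open>(1, 0)\<close> lies below it.
\<close>

lemma chord_share_half:
  assumes ch: "chord x0 y0 x1 y1" and "odds_share x0 y0 = odds_share x1 y1" "t \<in> {0..1}"
  defines "s \<equiv> chord_share x0 y0 x1 y1 t"
  shows "odds_share x0 y0 = 0 \<Longrightarrow> s < 1 / 2" "odds_share x0 y0 = 1 \<Longrightarrow> 1 / 2 < s"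
proof -
  let ?x = "along x0 x1 t" and ?y = "along y0 y1 t"
  have side: "on_side x0 y0" "on_side x1 y1" "x0 \<noteq> x1" "y0 \<noteq> y1"
    using ch by (auto simp: chord_def)
  have pos: "0 < ?x * (1 - ?y) + (1 - ?x) * ?y"
    using odds_denominator_pos[OF chord_closed[OF ch assms(3)]] .
  have mono: "along u v t < along u' v' t" if "u < u'" "v < v'" for u v u' v'
  proof (cases "t = 0")
    case False
    then have "t * v < t * v'" "(1 - t) * u \<le> (1 - t) * u'"
      using assms(3) that by (auto intro: mult_left_mono)
    then show ?thesis unfolding along_def by linarith
  qed (use that in auto)
  have half: "s < 1/2 \<longleftrightarrow> ?x < ?y" "1/2 < s \<longleftrightarrow> ?y < ?x"
    unfolding s_def chord_share_def odds_share_def using pos by (simp_all add: field_simps)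
  show "s < 1 / 2" if "odds_share x0 y0 = 0"
    unfolding half using that side assms(2) odds_share_side[OF side(1)] odds_share_side[OF side(2)]
    by (intro mono) (auto simp: on_side_def split: if_splits)
  show "1 / 2 < s" if "odds_share x0 y0 = 1"
    unfolding half using that side assms(2) odds_share_side[OF side(1)] odds_share_side[OF side(2)]
    by (intro mono) (auto simp: on_side_def split: if_splits)
qed

section \<open>The line of equal payoffs\<close>

text \<open>
  The differences between the rows are the values of the payoff gap at the corners of the square, and the
  differences within the rows are its slopes. So without ties the line avoids the corners and is not
  parallel to a side.
\<close>

definition no_ties :: "real^2^2 \<Rightarrow> bool" where
  "no_ties a \<longleftrightarrow> distinct [a$1$1, a$1$2, a$2$1, a$2$2]"

text \<open>
  One player's half of \<open>(*)\<close>. The payoff gap is \<open>a$1$1 - a$2$1\<close> at \<open>(1, 1)\<close> and \<open>a$1$2 - a$2$2\<close> at \<open>(0, 0)\<close>, so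
  without ties the condition says that the line of equal payoffs separates these two corners.
\<close>

definition crosses :: "real^2^2 \<Rightarrow> bool" where
  "crosses a \<longleftrightarrow> sgn (a$1$1 - a$2$1) = sgn (a$2$2 - a$1$2)"

definition indifference_chord :: "real^2^2 \<Rightarrow> real \<Rightarrow> real \<Rightarrow> real \<Rightarrow> real \<Rightarrow> bool" where
  "indifference_chord a x0 y0 x1 y1 \<longleftrightarrow> chord x0 y0 x1 y1 \<and>
     (\<forall>t. payoff_gap a (along x0 x1 t) (along y0 y1 t) = 0) \<and>
     (\<forall>x\<in>{0<..<1}. \<forall>y\<in>{0<..<1}. payoff_gap a x y = 0 \<longrightarrow>
        (\<exists>t\<in>{0<..<1}. x = along x0 x1 t \<and> y = along y0 y1 t))"

text \<open>
  The line is parametrized by the common payoff \<open>t\<close> of the two rows. Then \<open>x \<in> (0, 1)\<close> and \<open>y \<in> (0, 1)\<close> say that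
  \<open>t\<close> lies strictly between the payoffs in row 1 and strictly between those in row 2. So the chord is the
  intersection of two intervals. Each of its ends is one of the four payoffs, and the order of the payoffs
  decides on which sides the ends lie.
\<close>

lemma indifference_chord_cases:
  assumes "no_ties a"
  obtains (miss) "\<And>x y. x \<in> {0<..<1} \<Longrightarrow> y \<in> {0<..<1} \<Longrightarrow> payoff_gap a x y \<noteq> 0" "\<not> crosses a"
  | (hit) x0 y0 x1 y1 where "indifference_chord a x0 y0 x1 y1"
      "crosses a \<longleftrightarrow> odds_share x0 y0 \<noteq> odds_share x1 y1"
proof -
  define \<alpha> \<beta> \<gamma> \<delta> where "\<alpha> = a$1$1" and "\<beta> = a$1$2" and "\<gamma> = a$2$1" and "\<delta> = a$2$2"
  have d: "\<alpha> \<noteq> \<beta>" "\<alpha> \<noteq> \<gamma>" "\<alpha> \<noteq> \<delta>" "\<beta> \<noteq> \<gamma>" "\<beta> \<noteq> \<delta>" "\<gamma> \<noteq> \<delta>"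
    using assms by (auto simp: no_ties_def \<alpha>_def \<beta>_def \<gamma>_def \<delta>_def)
  have gain: "payoff_gap a x y = x * \<alpha> + (1 - x) * \<beta> - (y * \<gamma> + (1 - y) * \<delta>)" for x y
    by (simp add: payoff_gap_def \<alpha>_def \<beta>_def \<gamma>_def \<delta>_def)
  have cross: "crosses a \<longleftrightarrow> (\<gamma> < \<alpha> \<longleftrightarrow> \<beta> < \<delta>)"
    using d by (auto simp: crosses_def sgn_if simp flip: \<alpha>_def \<beta>_def \<gamma>_def \<delta>_def)
  define t0 where "t0 = max (min \<alpha> \<beta>) (min \<gamma> \<delta>)"
  define t1 where "t1 = min (max \<alpha> \<beta>) (max \<gamma> \<delta>)"
  define x where "x = (\<lambda>t. (t - \<beta>) / (\<alpha> - \<beta>))"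
  define y where "y = (\<lambda>t. (t - \<delta>) / (\<gamma> - \<delta>))"
  have frac: "(t - q) / (p - q) \<in> {0<..<1} \<longleftrightarrow> min p q < t \<and> t < max p q"
    if "p \<noteq> q" for p q t :: real
    using that by (cases "q < p") (auto simp: divide_simps)
  have x_int: "x t \<in> {0<..<1} \<longleftrightarrow> min \<alpha> \<beta> < t \<and> t < max \<alpha> \<beta>"
   and y_int: "y t \<in> {0<..<1} \<longleftrightarrow> min \<gamma> \<delta> < t \<and> t < max \<gamma> \<delta>" for t
    unfolding x_def y_def using frac d by blast+
  have x_ends: "x t = 0 \<longleftrightarrow> t = \<beta>" "x t = 1 \<longleftrightarrow> t = \<alpha>"
   and y_ends: "y t = 0 \<longleftrightarrow> t = \<delta>" "y t = 1 \<longleftrightarrow> t = \<gamma>" for t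
    using d by (auto simp: x_def y_def)
  have inv: "t = x t * \<alpha> + (1 - x t) * \<beta>" "t = y t * \<gamma> + (1 - y t) * \<delta>" for t
  proof -
    have "x t * (\<alpha> - \<beta>) = t - \<beta>" "y t * (\<gamma> - \<delta>) = t - \<delta>" using d by (auto simp: x_def y_def)
    then show "t = x t * \<alpha> + (1 - x t) * \<beta>" "t = y t * \<gamma> + (1 - y t) * \<delta>" by (auto simp: algebra_simps)
  qed
  have rep: "t \<in> {t0<..<t1} \<and> p = x t \<and> q = y t"
    if "payoff_gap a p q = 0" "t = p * \<alpha> + (1 - p) * \<beta>" "p \<in> {0<..<1}" "q \<in> {0<..<1}" for p q t
  proof -
    have "t = q * \<gamma> + (1 - q) * \<delta>" using that(1,2) by (simp add: gain)
    then have "t - \<beta> = p * (\<alpha> - \<beta>)" "t - \<delta> = q * (\<gamma> - \<delta>)"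
      using that(2) by (auto simp: algebra_simps)
    then have "p = x t" "q = y t" using d by (auto simp: x_def y_def)
    then show ?thesis using that(3,4) x_int[of t] y_int[of t] by (auto simp: t0_def t1_def)
  qed
  show ?thesis
  proof (cases "t0 < t1")
    case False
    show ?thesis
    proof (rule miss)
      show "payoff_gap a p q \<noteq> 0" if "p \<in> {0<..<1}" "q \<in> {0<..<1}" for p q
        using rep[OF _ refl that] False by auto
      show "\<not> crosses a"
        using False d unfolding cross t0_def t1_def by (auto simp: min_def max_def split: if_splits)
    qed
  next
    case True
    have side: "on_side (x t0) (y t0)" "on_side (x t1) (y t1)"
      using True d unfolding on_side_def x_int y_int insert_iff x_ends y_ends
      by (auto simp: t0_def t1_def min_def max_def split: if_splits)
    have sgn: "x t0 \<noteq> x t1" "y t0 \<noteq> y t1"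
      using True d by (auto simp: x_def y_def)
    have along: "along (x t0) (x t1) s = x ((1 - s) * t0 + s * t1)"
       "along (y t0) (y t1) s = y ((1 - s) * t0 + s * t1)" for s
      unfolding along_def x_def y_def times_divide_eq_right add_divide_distrib[symmetric]
      by (simp_all add: algebra_simps)
    show ?thesis
    proof (rule hit)
      show "indifference_chord a (x t0) (y t0) (x t1) (y t1)"
        unfolding indifference_chord_def chord_def
      proof (intro conjI allI ballI impI)
        show "payoff_gap a (along (x t0) (x t1) s) (along (y t0) (y t1) s) = 0" for s
          unfolding along gain using inv by (metis right_minus_eq)
        fix p q assume pq: "p \<in> {0<..<1}" "q \<in> {0<..<1}" "payoff_gap a p q = 0"
        then obtain t where t: "t \<in> {t0<..<t1}" "p = x t" "q = y t" using rep by blast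
        define s where "s = (t - t0) / (t1 - t0)"
        have "s * (t1 - t0) = t - t0" using True by (simp add: s_def)
        then have "(1 - s) * t0 + s * t1 = t" by (simp add: algebra_simps)
        moreover have "s \<in> {0<..<1}" using t True by (auto simp: s_def)
        ultimately show "\<exists>s\<in>{0<..<1}. p = along (x t0) (x t1) s \<and> q = along (y t0) (y t1) s"
          unfolding along using t by metis
      qed (use side sgn in auto)
      have "\<alpha> < \<beta> \<or> \<beta> < \<alpha>" "\<alpha> < \<gamma> \<or> \<gamma> < \<alpha>" "\<alpha> < \<delta> \<or> \<delta> < \<alpha>"
        "\<beta> < \<gamma> \<or> \<gamma> < \<beta>" "\<beta> < \<delta> \<or> \<delta> < \<beta>" "\<gamma> < \<delta> \<or> \<delta> < \<gamma>"
        using d by linarith+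
      then have "(\<gamma> < \<alpha> \<longleftrightarrow> \<beta> < \<delta>) \<longleftrightarrow> (t0 = \<beta> \<or> t0 = \<gamma>) \<noteq> (t1 = \<beta> \<or> t1 = \<gamma>)"
        using True unfolding t0_def t1_def min_def max_def by (elim disjE) simp_all
      then show "crosses a \<longleftrightarrow> odds_share (x t0) (y t0) \<noteq> odds_share (x t1) (y t1)"
        unfolding odds_share_side[OF side(1)] odds_share_side[OF side(2)] x_ends y_ends cross
        by simp
    qed
  qed
qed

text \<open>
  The coefficients of \<open>A\<^sup>2\<close>, \<open>A B\<close> and \<open>B\<^sup>2\<close> in the discriminant of
  \<open>B (t - a\<^sub>1\<^sub>2) (t - a\<^sub>2\<^sub>1) - A (t - a\<^sub>1\<^sub>1) (t - a\<^sub>2\<^sub>2)\<close> as a polynomial in \<open>t\<close>. Its roots are the common payoffs at which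
  the odds ratio along the line is \<open>A / B\<close>; they coincide when the line is tangent to
  the conic on which the odds ratio has this value.
\<close>

definition tangency_form :: "real^2^2 \<Rightarrow> real \<times> real \<times> real" where
  "tangency_form a = ((a$1$1 - a$2$2)\<^sup>2,
     4 * (a$1$2 * a$2$1 + a$1$1 * a$2$2) - 2 * (a$1$2 + a$2$1) * (a$1$1 + a$2$2),
     (a$1$2 - a$2$1)\<^sup>2)"

text \<open>
  The resultant of two binary quadratic forms, given by their coefficients.
\<close>

definition resultant :: "real \<times> real \<times> real \<Rightarrow> real \<times> real \<times> real \<Rightarrow> real" where
  "resultant f g = (case f of (p, q, r) \<Rightarrow> case g of (p', q', r') \<Rightarrow>
     (p * r' - p' * r)\<^sup>2 - (p * q' - p' * q) * (q * r' - q' * r))"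

lemma resultant_eq_0:
  assumes "p * A\<^sup>2 + q * (A * B) + r * B\<^sup>2 = 0" "p' * A\<^sup>2 + q' * (A * B) + r' * B\<^sup>2 = 0"
    and "A \<noteq> 0" "B \<noteq> 0"
  shows "resultant (p, q, r) (p', q', r') = 0"
proof -
  define s t u where "s = p * r' - p' * r" and "t = p * q' - p' * q" and "u = q * r' - q' * r"
  have "p * (p' * A\<^sup>2 + q' * (A * B) + r' * B\<^sup>2) - p' * (p * A\<^sup>2 + q * (A * B) + r * B\<^sup>2) =
     B * (t * A + s * B)" by (simp add: s_def t_def algebra_simps power2_eq_square)
  then have 1: "t * A + s * B = 0" using assms by simp
  have "r' * (p * A\<^sup>2 + q * (A * B) + r * B\<^sup>2) - r * (p' * A\<^sup>2 + q' * (A * B) + r' * B\<^sup>2) =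
     A * (s * A + u * B)" by (simp add: s_def u_def algebra_simps power2_eq_square)
  then have 2: "s * A + u * B = 0" using assms by simp
  have "s * (t * A + s * B) - t * (s * A + u * B) = (s\<^sup>2 - t * u) * B"
    by (simp add: algebra_simps power2_eq_square)
  then have "s\<^sup>2 - t * u = 0" using 1 2 assms(4) by simp
  then show ?thesis by (simp add: resultant_def s_def t_def u_def)
qed

text \<open>
  At an extremal point the polynomial in the common payoff \<open>t\<close> has a double root. Its discriminant is
  \<open>Q'\<^sup>2 - 4 (B - A) Q\<close>, evaluated at any \<open>t\<close>, where \<open>Q\<close> and \<open>Q'\<close> are the values of the polynomial and of its
  derivative; both are 0 at that point.
\<close>

lemma tangency_form_extremal:
  assumes "no_ties a" "payoff_gap a x y = 0" "payoff_gap a (x + dx) (y + dy) = 0" "dx \<noteq> 0"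
    and ex: "extremal_on dx dy x y" and "tangency_form a = (p, q, r)"
  shows "p * (x * (1 - y))\<^sup>2 + q * (x * (1 - y) * ((1 - x) * y)) + r * ((1 - x) * y)\<^sup>2 = 0"
proof -
  define \<alpha> \<beta> \<gamma> \<delta> where "\<alpha> = a$1$1" and "\<beta> = a$1$2" and "\<gamma> = a$2$1" and "\<delta> = a$2$2"
  define A B where "A = x * (1 - y)" and "B = (1 - x) * y"
  define t where "t = x * \<alpha> + (1 - x) * \<beta>"
  have t: "t = y * \<gamma> + (1 - y) * \<delta>"
    using assms(2) by (simp add: payoff_gap_def t_def \<alpha>_def \<beta>_def \<gamma>_def \<delta>_def)
  define u v where "u = \<alpha> - \<beta>" and "v = \<gamma> - \<delta>"
  have "u \<noteq> 0" "v \<noteq> 0" using assms(1) by (auto simp: no_ties_def u_def v_def \<alpha>_def \<beta>_def \<gamma>_def \<delta>_def)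
  have "payoff_gap a (x + dx) (y + dy) - payoff_gap a x y = dx * u - dy * v"
    by (simp add: payoff_gap_def u_def v_def \<alpha>_def \<beta>_def \<gamma>_def \<delta>_def algebra_simps)
  then have "dx * u = dy * v" using assms by simp
  then obtain k where k: "dx = k * v" "dy = k * u"
    using \<open>u \<noteq> 0\<close> \<open>v \<noteq> 0\<close> by (metis nonzero_eq_divide_eq times_divide_eq_left)
  then have "k \<noteq> 0" using \<open>dx \<noteq> 0\<close> by auto
  have diff: "t - \<beta> = u * x" "t - \<alpha> = - u * (1 - x)" "t - \<delta> = v * y" "t - \<gamma> = - v * (1 - y)"
  proof -
    show "t - \<beta> = u * x" "t - \<alpha> = - u * (1 - x)"
      by (simp_all add: t_def u_def algebra_simps)
    show "t - \<delta> = v * y" "t - \<gamma> = - v * (1 - y)"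
      unfolding t v_def by (simp_all add: algebra_simps)
  qed
  define Q where "Q = B * ((t - \<beta>) * (t - \<gamma>)) - A * ((t - \<alpha>) * (t - \<delta>))"
  define Q' where "Q' = B * ((t - \<beta>) + (t - \<gamma>)) - A * ((t - \<alpha>) + (t - \<delta>))"
  have "Q = 0" unfolding Q_def diff A_def B_def by (simp add: algebra_simps)
  moreover have "Q' = 0"
  proof -
    have "- k * Q' = (dx * (1 - y) - x * dy) * ((1 - x) * y) - x * (1 - y) * ((1 - x) * dy - dx * y)"
      unfolding Q'_def diff k A_def B_def by (simp add: algebra_simps)
    then show ?thesis using ex \<open>k \<noteq> 0\<close> by (simp add: extremal_on_def)
  qed
  moreover have "Q'\<^sup>2 - 4 * (B - A) * Q = (\<alpha> - \<delta>)\<^sup>2 * A\<^sup>2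
      + (4 * (\<beta> * \<gamma> + \<alpha> * \<delta>) - 2 * (\<beta> + \<gamma>) * (\<alpha> + \<delta>)) * (A * B) + (\<beta> - \<gamma>)\<^sup>2 * B\<^sup>2"
    unfolding Q_def Q'_def by (simp add: algebra_simps power2_eq_square)
  moreover have "p = (\<alpha> - \<delta>)\<^sup>2" "q = 4 * (\<beta> * \<gamma> + \<alpha> * \<delta>) - 2 * (\<beta> + \<gamma>) * (\<alpha> + \<delta>)" "r = (\<beta> - \<gamma>)\<^sup>2"
    using assms(6) by (auto simp: tangency_form_def \<alpha>_def \<beta>_def \<gamma>_def \<delta>_def)
  ultimately show ?thesis by (simp add: A_def B_def)
qed

text \<open>
  Equal extremal values of the two players would be a common root of the two tangency forms.
\<close>

lemma fold_values_differ:
  assumes "no_ties a" "no_ties b"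
    and a: "indifference_chord a x0 y0 x1 y1" and b: "indifference_chord b z0 w0 z1 w1"
    and c: "folds_at x0 y0 x1 y1 c" and d: "folds_at z0 w0 z1 w1 d"
    and res: "resultant (tangency_form a) (tangency_form b) \<noteq> 0"
  shows "chord_share x0 y0 x1 y1 c \<noteq> chord_share z0 w0 z1 w1 d"
proof
  assume eq: "chord_share x0 y0 x1 y1 c = chord_share z0 w0 z1 w1 d"
  obtain p q r where f: "tangency_form a = (p, q, r)" by (metis prod_cases3)
  obtain p' q' r' where g: "tangency_form b = (p', q', r')" by (metis prod_cases3)
  have step: "along u v (c + 1) = along u v c + (v - u)" for u v c
    by (simp add: along_def algebra_simps)
  define A B where "A = along x0 x1 c * (1 - along y0 y1 c)" and "B = (1 - along x0 x1 c) * along y0 y1 c"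
  define A' B' where "A' = along z0 z1 d * (1 - along w0 w1 d)" and "B' = (1 - along z0 z1 d) * along w0 w1 d"
  have ch: "chord x0 y0 x1 y1" "chord z0 w0 z1 w1" using a b by (auto simp: indifference_chord_def)
  have cd: "c \<in> {0<..<1}" "d \<in> {0<..<1}" using c d by (auto simp: folds_at_def)
  have pos: "0 < A" "0 < B" "0 < A'" "0 < B'"
    using chord_interior[OF ch(1) cd(1)] chord_interior[OF ch(2) cd(2)]
    by (auto simp: A_def B_def A'_def B'_def)
  have 1: "p * A\<^sup>2 + q * (A * B) + r * B\<^sup>2 = 0" unfolding A_def B_def
  proof (rule tangency_form_extremal[OF assms(1) _ _ _ _ f])
    show "extremal_on (x1 - x0) (y1 - y0) (along x0 x1 c) (along y0 y1 c)"
      using c by (simp add: folds_at_def)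
  qed (use a in \<open>auto simp: indifference_chord_def chord_def step[symmetric]\<close>)
  have 2: "p' * A'\<^sup>2 + q' * (A' * B') + r' * B'\<^sup>2 = 0" unfolding A'_def B'_def
  proof (rule tangency_form_extremal[OF assms(2) _ _ _ _ g])
    show "extremal_on (z1 - z0) (w1 - w0) (along z0 z1 d) (along w0 w1 d)"
      using d by (simp add: folds_at_def)
  qed (use b in \<open>auto simp: indifference_chord_def chord_def step[symmetric]\<close>)
  have "A / (A + B) = A' / (A' + B')"
    using eq by (simp add: chord_share_def odds_share_def A_def B_def A'_def B'_def)
  then have "A * (A' + B') = A' * (A + B)"
    using pos by (subst (asm) frac_eq_eq) auto
  then have ratio: "A * B' = A' * B" by (simp add: algebra_simps)
  define k where "k = A' / A"
  have "A' = k * A" "B' = k * B"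
    using pos ratio by (auto simp: k_def field_simps)
  moreover have "k \<noteq> 0" using pos by (simp add: k_def)
  ultimately have "k\<^sup>2 * (p' * A\<^sup>2 + q' * (A * B) + r' * B\<^sup>2) = 0"
    using 2 by (simp add: algebra_simps power2_eq_square)
  then have "p' * A\<^sup>2 + q' * (A * B) + r' * B\<^sup>2 = 0" using \<open>k \<noteq> 0\<close> by simp
  from resultant_eq_0[OF 1 this] pos res show False by (simp add: f g)
qed

section \<open>Curves on which two functions agree\<close>

text \<open>
  The simplex is the intersection of an open set with an affine hyperplane, so it is its own relative
  interior.
\<close>

lemma rel_frontier_open_simplexI:
  assumes "P \<in> closure open_simplex" "P \<notin> open_simplex"
  shows "P \<in> rel_frontier open_simplex"
proof -
  define U :: "(real^2^2) set" where "U = {P. 0 < P$1$1 \<and> 0 < P$1$2 \<and> 0 < P$2$1 \<and> 0 < P$2$2}"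
  define L :: "real^2^2 \<Rightarrow> real" where "L = (\<lambda>P. P$1$1 + P$1$2 + P$2$1 + P$2$2)"
  have "open U" unfolding U_def
    by (intro open_Collect_conj open_Collect_less continuous_intros)
  have "L (u *\<^sub>R P + v *\<^sub>R Q) = u * L P + v * L Q" for u v P Q
    by (simp add: L_def algebra_simps)
  then have "affine {P. L P = 1}" by (simp add: affine_def)
  then have hull: "affine hull open_simplex \<subseteq> {P. L P = 1}"
    by (rule hull_minimal[rotated]) (auto simp: open_simplex_iff L_def)
  have "open_simplex = U \<inter> {P. L P = 1}"
    unfolding U_def L_def by (auto simp only: open_simplex_iff)
  then have "open_simplex = affine hull open_simplex \<inter> U"
    using hull hull_subset[of open_simplex affine] by blast
  then have "openin (top_of_set (affine hull open_simplex)) open_simplex"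
    using \<open>open U\<close> by (metis openin_open_Int)
  then have "rel_interior open_simplex = open_simplex"
    by (rule rel_interior_openin)
  then show ?thesis using assms by (simp add: rel_frontier_def)
qed

lemma components_separated_pair:
  fixes f :: "'a::topological_space \<Rightarrow> real"
  assumes "connected A" "connected B" "A \<noteq> {}" "B \<noteq> {}"
    and f: "continuous_on (A \<union> B) f" "\<And>x. x \<in> A \<Longrightarrow> f x < c" "\<And>x. x \<in> B \<Longrightarrow> c < f x"
  shows "components (A \<union> B) = {A, B}" "A \<noteq> B"
proof -
  have sep: "D \<inter> A = {} \<or> D \<inter> B = {}" if "connected D" "D \<subseteq> A \<union> B" for D
  proof (rule ccontr)
    assume "\<not> (D \<inter> A = {} \<or> D \<inter> B = {})"
    then obtain p q where pq: "p \<in> D" "q \<in> D" "f p < c" "c < f q" using f by blast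
    have "connected (f ` D)"
      using that f(1) by (meson connected_continuous_image continuous_on_subset)
    then have "c \<in> f ` D"
      using pq by (meson connectedD_interval imageI less_imp_le)
    then show False using that f by fastforce
  qed
  have A: "A \<in> components (A \<union> B)" and B: "B \<in> components (A \<union> B)"
    unfolding in_components_maximal using assms sep by blast+
  show "components (A \<union> B) = {A, B}"
  proof (intro equalityI subsetI)
    fix C assume C: "C \<in> components (A \<union> B)"
    then have "C \<noteq> {}" "C \<subseteq> A \<union> B" by (auto simp: in_components_nonempty in_components_subset)
    then have "C \<inter> A \<noteq> {} \<or> C \<inter> B \<noteq> {}" by blast
    then show "C \<in> {A, B}" using components_nonoverlap[OF C A] components_nonoverlap[OF C B] by auto
  qed (use A B in auto)
  show "A \<noteq> B" using f assms by fastforce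
qed

lemma image_inj_interval:
  fixes u v :: real
  assumes h: "continuous_on {u..v} h" "inj_on h {u..v}" and "u \<le> v"
  shows "h ` {u..v} = closed_segment (h u) (h v :: real)"
proof -
  have "connected (h ` {u..v})" by (rule connected_continuous_image[OF h(1) connected_Icc])
  moreover have "h u \<in> h ` {u..v}" "h v \<in> h ` {u..v}" using \<open>u \<le> v\<close> by simp_all
  ultimately have "closed_segment (h u) (h v) \<subseteq> h ` {u..v}"
    using connected_contains_Icc[of "h ` {u..v}"] by (auto simp: closed_segment_eq_real_ivl)
  moreover have "h ` {u..v} \<subseteq> closed_segment (h u) (h v)"
  proof (rule image_subsetI)
    fix x assume "x \<in> {u..v}"
    then have "x = u \<or> x = v \<or> u < x \<and> x < v" by auto
    then show "h x \<in> closed_segment (h u) (h v)"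
      using continuous_inj_imp_mono[of u x v, OF _ _ h]
      by (auto simp: closed_segment_eq_real_ivl)
  qed
  ultimately show ?thesis by blast
qed

text \<open>
  \<open>\<Psi>\<close> maps the part of the unit square where \<open>\<phi> s = \<gamma> t\<close> to matrices, and \<open>\<sigma>\<close>, \<open>\<tau>\<close> recover \<open>s\<close> and \<open>t\<close> from
  points of the simplex. All assumptions are symmetric in the two parameters. So the two players can be
  exchanged without going back to games.
\<close>

locale matched_curve =
  fixes \<phi> \<gamma> :: "real \<Rightarrow> real" and \<Psi> :: "real \<Rightarrow> real \<Rightarrow> real^2^2" and \<sigma> \<tau> :: "real^2^2 \<Rightarrow> real"
  assumes cont_\<phi>: "continuous_on {0..1} \<phi>" and cont_\<gamma>: "continuous_on {0..1} \<gamma>"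
    and \<phi>_interior: "\<And>s. s \<in> {0<..<1} \<Longrightarrow> \<phi> s \<in> {0<..<1}"
    and \<gamma>_interior: "\<And>t. t \<in> {0<..<1} \<Longrightarrow> \<gamma> t \<in> {0<..<1}"
    and \<phi>_ends: "\<phi> 0 \<in> {0, 1}" "\<phi> 1 \<in> {0, 1}" and \<gamma>_ends: "\<gamma> 0 \<in> {0, 1}" "\<gamma> 1 \<in> {0, 1}"
    and cont_\<Psi>: "continuous_on ({0..1} \<times> {0..1}) (\<lambda>(s, t). \<Psi> s t)"
    and \<Psi>_interior: "\<And>s t. s \<in> {0<..<1} \<Longrightarrow> t \<in> {0<..<1} \<Longrightarrow> \<Psi> s t \<in> open_simplex"
    and \<Psi>_corner: "\<And>s t. s \<in> {0, 1} \<Longrightarrow> t \<in> {0, 1} \<Longrightarrow> \<phi> s = \<gamma> t \<Longrightarrow> \<Psi> s t \<notin> open_simplex"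
    and recover: "\<And>s t. s \<in> {0<..<1} \<Longrightarrow> t \<in> {0<..<1} \<Longrightarrow> \<phi> s = \<gamma> t \<Longrightarrow> \<sigma> (\<Psi> s t) = s \<and> \<tau> (\<Psi> s t) = t"
    and cont_\<sigma>: "continuous_on open_simplex \<sigma>" and cont_\<tau>: "continuous_on open_simplex \<tau>"
begin

text \<open>
  The part of the curve over parameters \<open>t\<close> in \<open>J\<close>. The set \<open>J\<close> will be \<open>UNIV\<close> or an interval on which \<open>\<gamma>\<close> is
  injective.
\<close>

definition piece :: "real set \<Rightarrow> (real^2^2) set" where
  "piece J = {\<Psi> s t |s t. s \<in> {0<..<1} \<and> t \<in> {0<..<1} \<inter> J \<and> \<phi> s = \<gamma> t}"

lemma flip: "matched_curve \<gamma> \<phi> (\<lambda>s t. \<Psi> t s) \<tau> \<sigma>"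
proof unfold_locales
  have "continuous_on ({0..1} \<times> {0..1}) ((\<lambda>(s, t). \<Psi> s t) \<circ> prod.swap)"
  proof (intro continuous_on_compose)
    show "continuous_on ({0..1} \<times> {0..1}) (prod.swap :: real \<times> real \<Rightarrow> _)"
      unfolding prod.swap_def by (intro continuous_intros)
    show "continuous_on (prod.swap ` ({0..1} \<times> {0..1})) (\<lambda>(s, t). \<Psi> s t)"
      using cont_\<Psi> by (simp add: product_swap)
  qed
  then show "continuous_on ({0..1} \<times> {0..1}) (\<lambda>(s, t). \<Psi> t s)"
    by (simp add: comp_def case_prod_unfold)
  show "\<Psi> t s \<notin> open_simplex" if "s \<in> {0, 1}" "t \<in> {0, 1}" "\<gamma> s = \<phi> t" for s t
    using \<Psi>_corner[of t s] that by simp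
  show "\<tau> (\<Psi> t s) = s \<and> \<sigma> (\<Psi> t s) = t" if "s \<in> {0<..<1}" "t \<in> {0<..<1}" "\<gamma> s = \<phi> t" for s t
    using recover[of t s] that by simp
qed (use cont_\<phi> cont_\<gamma> \<phi>_interior \<gamma>_interior \<phi>_ends \<gamma>_ends \<Psi>_interior cont_\<sigma> cont_\<tau> in simp_all)

lemma piece_flip: "matched_curve.piece \<gamma> \<phi> (\<lambda>s t. \<Psi> t s) UNIV = piece UNIV"
proof (intro equalityI subsetI)
  fix P assume "P \<in> matched_curve.piece \<gamma> \<phi> (\<lambda>s t. \<Psi> t s) UNIV"
  then obtain s t where "t \<in> {0<..<1}" "s \<in> {0<..<1}" "\<gamma> t = \<phi> s" "P = \<Psi> s t"
    unfolding matched_curve.piece_def[OF flip] by blast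
  then have "s \<in> {0<..<1} \<and> t \<in> {0<..<1} \<inter> UNIV \<and> \<phi> s = \<gamma> t" "P = \<Psi> s t" by simp_all
  then show "P \<in> piece UNIV" unfolding piece_def by blast
next
  fix P assume "P \<in> piece UNIV"
  then obtain s t where "t \<in> {0<..<1}" "s \<in> {0<..<1}" "\<phi> s = \<gamma> t" "P = \<Psi> s t"
    unfolding piece_def by blast
  then have "t \<in> {0<..<1} \<and> s \<in> {0<..<1} \<inter> UNIV \<and> \<gamma> t = \<phi> s" "P = \<Psi> s t" by simp_all
  then show "P \<in> matched_curve.piece \<gamma> \<phi> (\<lambda>s t. \<Psi> t s) UNIV"
    unfolding matched_curve.piece_def[OF flip] by blast
qed

lemma piece_subset: "piece J \<subseteq> open_simplex"
  using \<Psi>_interior by (auto simp: piece_def)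

text \<open>
  Where \<open>\<gamma>\<close> is injective on \<open>[u, v]\<close> and has all values of \<open>\<phi>\<close> there, the equation \<open>\<phi> s = \<gamma> t\<close> can be solved for
  \<open>t\<close>, and the solution is continuous because \<open>[u, v]\<close> is compact. So this piece is a graph over \<open>s\<close>. Since
  \<open>\<phi>\<close> and \<open>\<gamma>\<close> have the values 0 and 1 only at the ends of \<open>[0, 1]\<close>, the graph stays in the open square and runs
  from corner to corner.
\<close>

lemma branch:
  assumes J: "{u..v} \<subseteq> {0..1}" and inj: "inj_on \<gamma> {u..v}" and onto: "\<phi> ` {0..1} \<subseteq> \<gamma> ` {u..v}"
  shows "\<exists>t0\<in>{0, 1} \<inter> {u..v}. \<exists>t1\<in>{0, 1} \<inter> {u..v}. \<gamma> t0 = \<phi> 0 \<and> \<gamma> t1 = \<phi> 1 \<and>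
      (\<Psi> 0 t0 \<noteq> \<Psi> 1 t1 \<longrightarrow> open_arc_between (piece {u..v}) (\<Psi> 0 t0) (\<Psi> 1 t1))" (is ?arc)
    and "connected (piece {u..v})" "piece {u..v} \<noteq> {}"
proof -
  define T where "T = (\<lambda>s. inv_into {u..v} \<gamma> (\<phi> s))"
  have T: "T s \<in> {u..v}" "\<gamma> (T s) = \<phi> s" if "s \<in> {0..1}" for s
    using onto that inv_into_into[of "\<phi> s" \<gamma> "{u..v}"] f_inv_into_f[of "\<phi> s" \<gamma> "{u..v}"]
    unfolding T_def by blast+
  have T_unique: "t = T s" if "t \<in> {u..v}" "\<gamma> t = \<phi> s" for s t
    using that inj by (simp add: T_def flip: that(2))
  have T01: "T s \<in> {0..1}" if "s \<in> {0..1}" for s using T(1)[OF that] J by blast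
  have cont_T: "continuous_on {0..1} T"
  proof -
    have "continuous_on (\<gamma> ` {u..v}) (inv_into {u..v} \<gamma>)"
      using inj J by (intro continuous_on_inv continuous_on_subset[OF cont_\<gamma>]) auto
    then show ?thesis unfolding T_def
      using continuous_on_compose2[OF _ cont_\<phi>] onto by blast
  qed
  have T_int: "T s \<in> {0<..<1}" if "s \<in> {0<..<1}" for s
  proof -
    have "T s \<noteq> 0" "T s \<noteq> 1"
      using T(2)[of s] \<gamma>_ends \<phi>_interior[OF that] that by auto
    then show ?thesis using T01[of s] that by auto
  qed
  have T_end: "T s \<in> {0, 1}" if "s \<in> {0, 1}" for s
  proof (rule ccontr)
    assume "T s \<notin> {0, 1}"
    then have "T s \<in> {0<..<1}" using T01[of s] that by auto
    then show False using \<gamma>_interior[of "T s"] T(2)[of s] \<phi>_ends that by auto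
  qed
  define g where "g = (\<lambda>s. \<Psi> s (T s))"
  have "continuous_on {0..1} (\<lambda>s. (\<lambda>(s, t). \<Psi> s t) (s, T s))"
    by (rule continuous_on_compose2[OF cont_\<Psi>]) (use T01 in \<open>auto intro!: continuous_intros cont_T\<close>)
  then have cont_g: "continuous_on {0..1} g" by (simp add: g_def)
  have img: "g ` {0<..<1} = piece {u..v}"
  proof (intro equalityI subsetI)
    fix P assume "P \<in> g ` {0<..<1}"
    then obtain s where "s \<in> {0<..<1}" "P = \<Psi> s (T s)" by (auto simp: g_def)
    moreover have "T s \<in> {u..v}" "\<phi> s = \<gamma> (T s)" using T[of s] \<open>s \<in> {0<..<1}\<close> by auto
    ultimately show "P \<in> piece {u..v}" using T_int unfolding piece_def by blast
  next
    fix P assume "P \<in> piece {u..v}"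
    then obtain s t where "s \<in> {0<..<1}" "t \<in> {u..v}" "\<phi> s = \<gamma> t" "P = \<Psi> s t"
      by (auto simp: piece_def)
    then show "P \<in> g ` {0<..<1}" using T_unique[of t s] by (auto simp: g_def)
  qed
  have "continuous_on {0<..<1} g" by (rule continuous_on_subset[OF cont_g]) auto
  then have conn: "connected (piece {u..v})"
    unfolding img[symmetric] by (intro connected_continuous_image connected_Ioo)
  have corner: "g 0 \<notin> open_simplex" "g 1 \<notin> open_simplex"
    using \<Psi>_corner[of 0 "T 0"] \<Psi>_corner[of 1 "T 1"] T_end[of 0] T_end[of 1] T(2)[of 0] T(2)[of 1]
    by (auto simp: g_def)
  \<comment> \<open>The end points are limits of points of the simplex and do not belong to it.\<close>
  have "g ` closure {0<..<1} \<subseteq> closure (g ` {0<..<1})"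
    using cont_g by (intro image_closure_subset) (auto simp: closure_subset)
  moreover have "g 0 \<in> g ` {0..1}" "g 1 \<in> g ` {0..1}" by simp_all
  ultimately have "g 0 \<in> closure open_simplex" "g 1 \<in> closure open_simplex"
    using closure_mono[OF piece_subset[of "{u..v}"]] unfolding img by (auto simp: subset_iff)
  then have frontier: "g 0 \<in> rel_frontier open_simplex" "g 1 \<in> rel_frontier open_simplex"
    using corner rel_frontier_open_simplexI by blast+
  have "open_arc_between (piece {u..v}) (g 0) (g 1)" if ne: "g 0 \<noteq> g 1"
    unfolding open_arc_between_def
  proof (intro conjI frontier exI[of _ g])
    have interior: "g s \<in> open_simplex" "\<sigma> (g s) = s" if "s \<in> {0<..<1}" for s
      using \<Psi>_interior[OF that T_int[OF that]] recover[OF that T_int[OF that]] T(2)[of s] that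
      by (auto simp: g_def)
    have dich: "s = 0 \<or> s = 1 \<or> s \<in> {0<..<1}" if "s \<in> {0..1}" for s :: real using that by auto
    have "inj_on g {0..1}"
    proof (rule linorder_inj_onI')
      fix s t :: real assume st: "s \<in> {0..1}" "t \<in> {0..1}" "s < t"
      then consider "s = 0" "t = 1" | "s = 0 \<or> s = 1" "t \<in> {0<..<1}"
        | "t = 0 \<or> t = 1" "s \<in> {0<..<1}" | "s \<in> {0<..<1}" "t \<in> {0<..<1}"
        using dich[of s] dich[of t] by fastforce
      then show "g s \<noteq> g t"
      proof cases
        case 4
        then show ?thesis using interior(2)[of s] interior(2)[of t] st by auto
      qed (use ne corner interior(1)[of s] interior(1)[of t] in auto)
    qed
    then show "arc g" using cont_g by (simp add: arc_def path_def)
  qed (use img in \<open>auto simp: pathstart_def pathfinish_def\<close>)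
  then show ?arc
    by (intro bexI[of _ "T 0"] bexI[of _ "T 1"]) (use T[of 0] T[of 1] T_end in \<open>simp_all add: g_def\<close>)
  show "connected (piece {u..v})" by (rule conn)
  show "piece {u..v} \<noteq> {}" unfolding img[symmetric] by simp
qed

lemma piece_UNIV: "piece {0..1} = piece UNIV"
  unfolding piece_def by (intro Collect_cong ex_cong1) auto

lemma piece_Un: "piece (I \<union> J) = piece I \<union> piece J"
  unfolding piece_def by auto

lemma onto_unit:
  assumes "\<gamma> 0 \<noteq> \<gamma> 1"
  shows "\<phi> ` {0..1} \<subseteq> \<gamma> ` {0..1}"
proof -
  have "connected (\<gamma> ` {0..1})" using cont_\<gamma> by (intro connected_continuous_image) auto
  moreover have "0 \<in> \<gamma> ` {0..1}" "1 \<in> \<gamma> ` {0..1}" using \<gamma>_ends assms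
     by (force simp: image_iff)+
  ultimately have "{0..1} \<subseteq> \<gamma> ` {0..1}" by (meson connected_contains_Icc)
  moreover have "\<phi> s \<in> {0..1}" if "s \<in> {0..1}" for s
  proof -
    have "s = 0 \<or> s = 1 \<or> s \<in> {0<..<1}" using that by auto
    then show ?thesis using \<phi>_ends \<phi>_interior[of s] by auto
  qed
  ultimately show ?thesis by blast
qed

lemma fold_image:
  assumes "c \<in> {0<..<1}" "inj_on \<gamma> {0..c}" "inj_on \<gamma> {c..1}" "\<gamma> 0 = \<gamma> 1"
  shows "\<gamma> ` {0..1} = closed_segment (\<gamma> 0) (\<gamma> c)"
proof -
  have c': "0 \<le> c" "c \<le> 1" using assms(1) by auto
  have sub: "{0..c} \<subseteq> {0..1}" "{c..1} \<subseteq> {0..1}" using c' by auto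
  have "\<gamma> ` {0..c} = closed_segment (\<gamma> 0) (\<gamma> c)"
    by (rule image_inj_interval[OF continuous_on_subset[OF cont_\<gamma> sub(1)] assms(2) c'(1)])
  moreover have "\<gamma> ` {c..1} = closed_segment (\<gamma> c) (\<gamma> 1)"
    by (rule image_inj_interval[OF continuous_on_subset[OF cont_\<gamma> sub(2)] assms(3) c'(2)])
  moreover have "{0..1} = {0..c} \<union> {c..1}" using c' by auto
  ultimately show ?thesis using assms(4) by (simp add: image_Un closed_segment_commute)
qed

text \<open>
  The values of \<open>\<phi>\<close> avoid the extremal value \<open>\<gamma> c\<close>, so no point of the curve has \<open>t = c\<close>. The continuous
  function \<open>\<tau>\<close> separates the two branches \<open>t < c\<close> and \<open>t > c\<close>.
\<close>

lemma two_branches: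
  assumes c: "c \<in> {0<..<1}" "inj_on \<gamma> {0..c}" "inj_on \<gamma> {c..1}" and ends: "\<gamma> 0 = \<gamma> 1"
    and onto: "\<phi> ` {0..1} \<subseteq> closed_segment (\<gamma> 0) (\<gamma> c) - {\<gamma> c}"
  shows "components (piece UNIV) = {piece {0..c}, piece {c..1}}" "piece {0..c} \<noteq> piece {c..1}"
    "\<Psi> 0 0 \<noteq> \<Psi> 1 0 \<Longrightarrow> open_arc_between (piece {0..c}) (\<Psi> 0 0) (\<Psi> 1 0)"
    "\<Psi> 0 1 \<noteq> \<Psi> 1 1 \<Longrightarrow> open_arc_between (piece {c..1}) (\<Psi> 0 1) (\<Psi> 1 1)"
proof -
  have c': "0 \<le> c" "c \<le> 1" "0 < c" "c < 1" using c by auto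
  have sub: "{0..c} \<subseteq> {0..1}" "{c..1} \<subseteq> {0..1}" using c' by auto
  have "\<gamma> ` {0..c} = closed_segment (\<gamma> 0) (\<gamma> c)"
    by (rule image_inj_interval[OF continuous_on_subset[OF cont_\<gamma> sub(1)] c(2) c'(1)])
  then have o1: "\<phi> ` {0..1} \<subseteq> \<gamma> ` {0..c}" using onto by blast
  have "\<gamma> ` {c..1} = closed_segment (\<gamma> c) (\<gamma> 1)"
    by (rule image_inj_interval[OF continuous_on_subset[OF cont_\<gamma> sub(2)] c(3) c'(2)])
  then have "\<gamma> ` {c..1} = closed_segment (\<gamma> 0) (\<gamma> c)" using ends by (simp add: closed_segment_commute)
  then have o2: "\<phi> ` {0..1} \<subseteq> \<gamma> ` {c..1}" using onto by blast
  note b1 = branch[OF sub(1) c(2) o1] and b2 = branch[OF sub(2) c(3) o2]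
  have "{0, 1} \<inter> {0..c} = {0}" "{0, 1} \<inter> {c..1} = {1}" using c' by auto
  then show "\<Psi> 0 0 \<noteq> \<Psi> 1 0 \<Longrightarrow> open_arc_between (piece {0..c}) (\<Psi> 0 0) (\<Psi> 1 0)"
    and "\<Psi> 0 1 \<noteq> \<Psi> 1 1 \<Longrightarrow> open_arc_between (piece {c..1}) (\<Psi> 0 1) (\<Psi> 1 1)"
    using b1(1) b2(1) by simp_all
  have "{0..1} = {0..c} \<union> {c..1}" using c' by auto
  then have un: "piece UNIV = piece {0..c} \<union> piece {c..1}"
    unfolding piece_UNIV[symmetric] by (simp only: piece_Un)
  have side: "\<tau> P = t \<and> t \<noteq> c" if "s \<in> {0<..<1}" "t \<in> {0<..<1}" "\<phi> s = \<gamma> t" "P = \<Psi> s t" for s t P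
  proof -
    have "\<phi> s \<in> \<phi> ` {0..1}" using that(1) by auto
    then have "\<gamma> t \<noteq> \<gamma> c" using onto that(3) by auto
    then show ?thesis using recover that by auto
  qed
  have cont: "continuous_on (piece {0..c} \<union> piece {c..1}) \<tau>"
    by (rule continuous_on_subset[OF cont_\<tau>]) (simp add: piece_subset)
  have below: "\<tau> P < c" if P: "P \<in> piece {0..c}" for P
  proof -
    obtain s t where "s \<in> {0<..<1}" "t \<in> {0<..<1}" "t \<in> {0..c}" "\<phi> s = \<gamma> t" "P = \<Psi> s t"
      using P unfolding piece_def by blast
    then show ?thesis using side[of s t P] by simp
  qed
  have above: "c < \<tau> P" if P: "P \<in> piece {c..1}" for P
  proof -
    obtain s t where "s \<in> {0<..<1}" "t \<in> {0<..<1}" "t \<in> {c..1}" "\<phi> s = \<gamma> t" "P = \<Psi> s t"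
      using P unfolding piece_def by blast
    then show ?thesis using side[of s t P] by simp
  qed
  note pair = components_separated_pair[OF b1(2) b2(2) b1(3) b2(3) cont below above]
  show "components (piece UNIV) = {piece {0..c}, piece {c..1}}"
    unfolding un by (rule pair(1))
  show "piece {0..c} \<noteq> piece {c..1}" by (rule pair(2))
qed

lemma one_branch:
  assumes "inj_on \<gamma> {0..1}" "\<gamma> 0 \<noteq> \<gamma> 1"
  shows "\<exists>t0\<in>{0, 1}. \<exists>t1\<in>{0, 1}. \<gamma> t0 = \<phi> 0 \<and> \<gamma> t1 = \<phi> 1 \<and>
      (\<Psi> 0 t0 \<noteq> \<Psi> 1 t1 \<longrightarrow> open_arc_between (piece UNIV) (\<Psi> 0 t0) (\<Psi> 1 t1))"
    and "components (piece UNIV) = {piece UNIV}"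
proof -
  have "{0, 1} \<inter> {0..1} = {0, 1 :: real}" by auto
  with branch[OF order_refl assms(1) onto_unit[OF assms(2)]]
  show "\<exists>t0\<in>{0, 1}. \<exists>t1\<in>{0, 1}. \<gamma> t0 = \<phi> 0 \<and> \<gamma> t1 = \<phi> 1 \<and>
      (\<Psi> 0 t0 \<noteq> \<Psi> 1 t1 \<longrightarrow> open_arc_between (piece UNIV) (\<Psi> 0 t0) (\<Psi> 1 t1))"
    and "components (piece UNIV) = {piece UNIV}"
    by (simp_all only: piece_UNIV components_eq_sing_iff simp_thms)
qed

end

section \<open>Boundary points of the curve\<close>

lemma span_scale_eq: "c \<noteq> 0 \<Longrightarrow> span {c *\<^sub>R P} = span {P}" for P :: "'a::real_vector"
proof -
  assume c: "c \<noteq> 0"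
  have "P = (1 / c) *\<^sub>R (c *\<^sub>R P)" using c by simp
  then have "P \<in> span {c *\<^sub>R P}" by (metis span_base span_scale singletonI)
  moreover have "c *\<^sub>R P \<in> span {P}" by (simp add: span_base span_scale)
  ultimately show ?thesis by (intro span_eq[THEN iffD2]) simp
qed

definition one_nonzero :: "real^2^2 \<Rightarrow> bool" where
  "one_nonzero P \<longleftrightarrow> (\<exists>i j. \<forall>k m. P$k$m \<noteq> 0 \<longleftrightarrow> k = i \<and> m = j)"

definition one_zero :: "real^2^2 \<Rightarrow> bool" where
  "one_zero P \<longleftrightarrow> (\<exists>i j. \<forall>k m. P$k$m = 0 \<longleftrightarrow> k = i \<and> m = j)"

lemma span_eq_E_pt_iff: "span {P} = E_pt i j \<longleftrightarrow> (\<forall>k m. P$k$m \<noteq> 0 \<longleftrightarrow> k = i \<and> m = j)"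
proof
  assume *: "span {P} = E_pt i j"
  then have "P \<in> span {axis i (axis j 1)}" by (metis E_pt_def span_base singletonI)
  then obtain c where P: "P = c *\<^sub>R axis i (axis j 1)" by (auto simp: span_singleton)
  have "axis i (axis j 1) \<in> span {P}" using * by (simp add: E_pt_def span_base)
  then have "c \<noteq> 0" unfolding P by (auto simp: axis_eq_0_iff)
  then show "\<forall>k m. P$k$m \<noteq> 0 \<longleftrightarrow> k = i \<and> m = j"
    unfolding P by (auto simp: axis_def)
next
  assume *: "\<forall>k m. P$k$m \<noteq> 0 \<longleftrightarrow> k = i \<and> m = j"
  have "P = (P$i$j) *\<^sub>R axis i (axis j 1)"
    unfolding vec_eq_iff using * by (auto simp: axis_def)
  then have "span {P} = span {(P$i$j) *\<^sub>R axis i (axis j 1)}" by simp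
  also have "\<dots> = E_pt i j" using * by (simp add: E_pt_def span_scale_eq)
  finally show "span {P} = E_pt i j" .
qed

lemma is_E_iff_one_nonzero: "is_E P \<longleftrightarrow> one_nonzero P"
  by (simp add: is_E_def one_nonzero_def span_eq_E_pt_iff)

lemma forall_2_pairs:
  fixes i i' j j' :: 2
  assumes "i \<noteq> i'" "j \<noteq> j'"
  shows "(\<forall>k m. R k m) \<longleftrightarrow> R i j \<and> R i j' \<and> R i' j \<and> R i' j'"
  using assms exhaust_2[of i] exhaust_2[of i'] exhaust_2[of j] exhaust_2[of j'] by (auto simp: forall_2)

lemma one_nonzeroI:
  assumes "i \<noteq> i'" "j \<noteq> j'" "Q \<noteq> 0" "Q$i$j' = 0" "Q$i'$j = 0" "Q$i'$j' = 0"
  shows "one_nonzero Q"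
proof -
  have "Q$i$j \<noteq> 0"
  proof
    assume "Q$i$j = 0"
    then have "Q = 0"
      unfolding vec_eq_iff forall_2_pairs[OF assms(1,2)] using assms(4-6) by simp
    then show False using assms(3) by simp
  qed
  then have "\<forall>k m. Q$k$m \<noteq> 0 \<longleftrightarrow> k = i \<and> m = j"
    unfolding forall_2_pairs[OF assms(1,2)] using assms by simp
  then show ?thesis unfolding one_nonzero_def by blast
qed

lemma one_zero_iff: "one_zero P \<longleftrightarrow>
    P$1$1 = 0 \<and> P$1$2 \<noteq> 0 \<and> P$2$1 \<noteq> 0 \<and> P$2$2 \<noteq> 0 \<or>
    P$1$1 \<noteq> 0 \<and> P$1$2 = 0 \<and> P$2$1 \<noteq> 0 \<and> P$2$2 \<noteq> 0 \<or>
    P$1$1 \<noteq> 0 \<and> P$1$2 \<noteq> 0 \<and> P$2$1 = 0 \<and> P$2$2 \<noteq> 0 \<or>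
    P$1$1 \<noteq> 0 \<and> P$1$2 \<noteq> 0 \<and> P$2$1 \<noteq> 0 \<and> P$2$2 = 0"
proof -
  have ex: "(\<exists>i. R i) \<longleftrightarrow> R 1 \<or> R 2" for R :: "2 \<Rightarrow> bool" by (metis exhaust_2)
  show ?thesis unfolding one_zero_def ex forall_2 by simp
qed

lemma one_nonzero_iff: "one_nonzero P \<longleftrightarrow>
    P$1$1 \<noteq> 0 \<and> P$1$2 = 0 \<and> P$2$1 = 0 \<and> P$2$2 = 0 \<or>
    P$1$1 = 0 \<and> P$1$2 \<noteq> 0 \<and> P$2$1 = 0 \<and> P$2$2 = 0 \<or>
    P$1$1 = 0 \<and> P$1$2 = 0 \<and> P$2$1 \<noteq> 0 \<and> P$2$2 = 0 \<or>
    P$1$1 = 0 \<and> P$1$2 = 0 \<and> P$2$1 = 0 \<and> P$2$2 \<noteq> 0"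
proof -
  have ex: "(\<exists>i. R i) \<longleftrightarrow> R 1 \<or> R 2" for R :: "2 \<Rightarrow> bool" by (metis exhaust_2)
  show ?thesis unfolding one_nonzero_def ex forall_2 by simp
qed

text \<open>
  On the plane \<open>P$i$j = 0\<close> each determinant is a product of two linear forms. Without ties, common zeros at
  which one of the first factors vanishes are coordinate points, while the two second factors have one
  common zero in the plane.
\<close>

lemma det_M_opposite:
  assumes "i \<noteq> i'" "j \<noteq> j'" "P$i$j = 0"
  shows "det (M1 X P) = 0 \<longleftrightarrow> P$i$j' * ((fst X$i'$j - fst X$i$j') * P$i'$j
             + (fst X$i'$j' - fst X$i$j') * P$i'$j') = 0"
    "det (M2 X P) = 0 \<longleftrightarrow> P$i'$j * ((snd X$i$j' - snd X$i'$j) * P$i$j'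
             + (snd X$i'$j' - snd X$i'$j) * P$i'$j') = 0"
proof -
  consider "i = 1 \<and> i' = 2 \<and> j = 1 \<and> j' = 2" | "i = 1 \<and> i' = 2 \<and> j = 2 \<and> j' = 1"
    | "i = 2 \<and> i' = 1 \<and> j = 1 \<and> j' = 2" | "i = 2 \<and> i' = 1 \<and> j = 2 \<and> j' = 1"
    using assms(1,2) exhaust_2[of i] exhaust_2[of i'] exhaust_2[of j] exhaust_2[of j'] by auto
  then have "det (M1 X P) = (if i = 1 then 1 else - 1) * (P$i$j' * ((fst X$i'$j - fst X$i$j') * P$i'$j
             + (fst X$i'$j' - fst X$i$j') * P$i'$j'))" and
    "det (M2 X P) = (if j = 1 then 1 else - 1) * (P$i'$j * ((snd X$i$j' - snd X$i'$j) * P$i$j'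
             + (snd X$i'$j' - snd X$i'$j) * P$i'$j'))"
    using assms(3) by (cases; simp add: det_M1 det_M2 left_diff_distrib right_diff_distrib distrib_left distrib_right)+
  then show "det (M1 X P) = 0 \<longleftrightarrow> P$i$j' * ((fst X$i'$j - fst X$i$j') * P$i'$j
             + (fst X$i'$j' - fst X$i$j') * P$i'$j') = 0"
    "det (M2 X P) = 0 \<longleftrightarrow> P$i'$j * ((snd X$i$j' - snd X$i'$j) * P$i$j'
             + (snd X$i'$j' - snd X$i'$j) * P$i'$j') = 0"
    by (simp_all only: mult_eq_0_iff split: if_splits) simp_all
qed

lemma no_ties_opposite:
  assumes "no_ties a" "i \<noteq> i'" "j \<noteq> j'"
  shows "a$i'$j \<noteq> a$i$j'" "a$i'$j' \<noteq> a$i$j'" "a$i'$j' \<noteq> a$i'$j"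
  using assms exhaust_2[of i] exhaust_2[of i'] exhaust_2[of j] exhaust_2[of j']
  by (auto simp: no_ties_def)

text \<open>
  The description that defines \<open>F_pt\<close> has to be satisfied by one line only. A point of the plane
  \<open>P$i$j = 0\<close> on the variety that is not a coordinate point has three nonzero entries, and the two linear
  factors fix their ratios.
\<close>

lemma is_F_if_one_zero:
  assumes ties: "no_ties (fst X)" "no_ties (snd X)"
    and det: "det (M1 X P) = 0" "det (M2 X P) = 0" and "one_zero P"
  shows "is_F X P"
proof -
  obtain i j where ij: "\<And>k m. P$k$m = 0 \<longleftrightarrow> k = i \<and> m = j"
    using \<open>one_zero P\<close> by (auto simp: one_zero_def)
  have "\<exists>i'. i \<noteq> i'" "\<exists>j'. j \<noteq> j'" by (metis zero_neq_one)+
  then obtain i' j' where ne: "i \<noteq> i'" "j \<noteq> j'" by blast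
  define \<alpha> \<beta> \<gamma> \<delta> where "\<alpha> = fst X$i'$j - fst X$i$j'" and "\<beta> = fst X$i'$j' - fst X$i$j'"
    and "\<gamma> = snd X$i$j' - snd X$i'$j" and "\<delta> = snd X$i'$j' - snd X$i'$j"
  have nz: "\<alpha> \<noteq> 0" "\<beta> \<noteq> 0" "\<gamma> \<noteq> 0" "\<delta> \<noteq> 0"
    using no_ties_opposite[OF ties(1) ne] no_ties_opposite[OF ties(2) ne]
    by (auto simp: \<alpha>_def \<beta>_def \<gamma>_def \<delta>_def)
  note opp = det_M_opposite[OF ne, where X = X, folded \<alpha>_def \<beta>_def \<gamma>_def \<delta>_def]
  have "P$i'$j' \<noteq> 0" using ij[of i' j'] ne by auto
  then have "P \<noteq> 0" by auto
  then have P0: "P \<noteq> 0" "P$i$j = 0" "P$i$j' \<noteq> 0" "P$i'$j \<noteq> 0" "P$i'$j' \<noteq> 0"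
    using ij[of i j] ij[of i j'] ij[of i' j] ij[of i' j'] ne by simp_all
  have P_lin: "\<alpha> * P$i'$j = - \<beta> * P$i'$j'" "\<gamma> * P$i$j' = - \<delta> * P$i'$j'"
    using det opp[OF P0(2)] P0 by (auto simp: add_eq_0_iff)
  have "F_pt X i j = span {P}" unfolding F_pt_def
  proof (rule the_equality)
    have "span {P} \<subseteq> {Q. Q$i$j = 0}" using P0(2) by (auto simp: span_singleton)
    moreover have "span {P} \<noteq> E_pt k m" for k m
    proof
      assume "span {P} = E_pt k m"
      then have "i = k \<and> j' = m" "i' = k \<and> j' = m" using P0(3,5) unfolding span_eq_E_pt_iff by blast+
      then show False using ne by simp
    qed
    ultimately show "span {P} \<in> spohn_variety X \<and> span {P} \<subseteq> {P. P$i$j = 0} \<and> (\<forall>k m. span {P} \<noteq> E_pt k m)"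
      using det P0(1) span_in_spohn_variety_iff by blast
  next
    fix l assume l: "l \<in> spohn_variety X \<and> l \<subseteq> {P. P$i$j = 0} \<and> (\<forall>k m. l \<noteq> E_pt k m)"
    then obtain Q where Q: "l = span {Q}" "Q \<noteq> 0" "det (M1 X Q) = 0" "det (M2 X Q) = 0"
      unfolding spohn_variety_def by blast
    have Qij: "Q$i$j = 0" using l Q(1) span_base[of Q "{Q}"] by auto
    have "\<not> one_nonzero Q" using l Q(1) by (auto simp: is_E_iff_one_nonzero[symmetric] is_E_def)
    then have two: "\<not> (Q$i$j' = 0 \<and> Q$i'$j = 0)" "\<not> (Q$i$j' = 0 \<and> Q$i'$j' = 0)" "\<not> (Q$i'$j = 0 \<and> Q$i'$j' = 0)"
      using Qij one_nonzeroI[OF ne(1)[symmetric] ne(2)[symmetric] Q(2)]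
        one_nonzeroI[OF ne(1)[symmetric] ne(2) Q(2)] one_nonzeroI[OF ne(1) ne(2)[symmetric] Q(2)] by blast+
    have "Q$i$j' \<noteq> 0" "Q$i'$j \<noteq> 0"
      using opp[OF Qij] Q(3,4) two nz by auto
    then have Q_lin: "\<alpha> * Q$i'$j = - \<beta> * Q$i'$j'" "\<gamma> * Q$i$j' = - \<delta> * Q$i'$j'"
      using opp[OF Qij] Q(3,4) by (auto simp: add_eq_0_iff)
    define c where "c = Q$i'$j' / P$i'$j'"
    have c: "Q$i'$j' = c * P$i'$j'" using P0 by (simp add: c_def)
    have "\<alpha> * Q$i'$j = \<alpha> * (c * P$i'$j)" "\<gamma> * Q$i$j' = \<gamma> * (c * P$i$j')"
      unfolding mult.left_commute[of _ c] P_lin Q_lin c by simp_all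
    then have "Q$i'$j = c * P$i'$j" "Q$i$j' = c * P$i$j'" using nz by simp_all
    then have "Q = c *\<^sub>R P"
      unfolding vec_eq_iff forall_2_pairs[OF ne] using c Qij P0(2) by simp
    moreover from this have "c \<noteq> 0" using Q(2) by auto
    ultimately show "l = span {P}" using Q(1) by (simp add: span_scale_eq)
  qed
  then show ?thesis unfolding is_F_def by (intro exI[of _ i] exI[of _ j]) simp
qed

text \<open>
  On the sides \<open>x = 0\<close>, \<open>x = 1\<close>, \<open>y = 0\<close>, \<open>y = 1\<close> the entries 11, 12, 21, 22 vanish compared to the other entry in
  the same row; on the sides \<open>z = 0\<close>, \<open>z = 1\<close>, \<open>w = 0\<close>, \<open>w = 1\<close> the entries 11, 21, 12, 22 vanish compared to the
  other entry in the same column. The predicate says that both points single out the same entry.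
\<close>

definition same_event :: "real \<Rightarrow> real \<Rightarrow> real \<Rightarrow> real \<Rightarrow> bool" where
  "same_event x y z w \<longleftrightarrow> x = 0 \<and> z = 0 \<or> y = 1 \<and> w = 1 \<or> x = 1 \<and> w = 0 \<or> y = 0 \<and> z = 1"

lemma joint_zeros:
  assumes "on_side x y" "z \<in> {0..1}" "w \<in> {0..1}"
  defines "P \<equiv> joint x y z w"
  defines "m0 \<equiv> (z = 0 \<or> y = 0) \<and> (w = 0 \<or> y = 1)" and "n0 \<equiv> (z = 1 \<or> x = 0) \<and> (w = 1 \<or> x = 1)"
  shows "P$1$1 = 0 \<longleftrightarrow> x = 0 \<or> m0" "P$1$2 = 0 \<longleftrightarrow> x = 1 \<or> m0"
    "P$2$1 = 0 \<longleftrightarrow> y = 0 \<or> n0" "P$2$2 = 0 \<longleftrightarrow> y = 1 \<or> n0"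
proof -
  define m n where "m = z * y + w * (1 - y)" and "n = (1 - z) * x + (1 - w) * (1 - x)"
  have xy: "x \<in> {0..1}" "y \<in> {0..1}" "x \<in> {0<..<1} \<or> y \<in> {0<..<1}"
    using assms(1) by (auto simp: on_side_def)
  have pos: "m + n \<noteq> 0"
    using joint_denominator_pos[OF xy(1,2) assms(2,3) xy(3)] by (simp add: m_def n_def)
  have "0 \<le> z * y" "0 \<le> w * (1 - y)" "0 \<le> (1 - z) * x" "0 \<le> (1 - w) * (1 - x)"
    using xy assms(2,3) by auto
  then have "m = 0 \<longleftrightarrow> m0" "n = 0 \<longleftrightarrow> n0"
    unfolding m_def n_def m0_def n0_def by (auto simp: add_nonneg_eq_0_iff)
  then show "P$1$1 = 0 \<longleftrightarrow> x = 0 \<or> m0" "P$1$2 = 0 \<longleftrightarrow> x = 1 \<or> m0"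
    "P$2$1 = 0 \<longleftrightarrow> y = 0 \<or> n0" "P$2$2 = 0 \<longleftrightarrow> y = 1 \<or> n0"
    using pos unfolding P_def joint_rows[OF m_def n_def] by auto
qed

lemma on_side_cases:
  assumes "on_side x y"
  obtains "x = 0" "0 < y" "y < 1" | "x = 1" "0 < y" "y < 1" | "y = 0" "0 < x" "x < 1" | "y = 1" "0 < x" "x < 1"
  using assms by (auto simp: on_side_def)

text \<open>
  If the entries that vanish in their row and in their column coincide, the remaining three ratios are
  finite and nonzero. If not, then for equal odds ratios they are opposite entries of the matrix, and one
  further entry dominates both of them and, through one of them, the fourth. The last statement recovers
  the common odds ratio from the zero pattern. It shows that corners with different odds ratios are
  different points.
\<close>

lemma
  assumes xy: "on_side x y" and zw: "on_side z w" and eq: "odds_share x y = odds_share z w"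
  shows one_zero_joint: "same_event x y z w \<Longrightarrow> one_zero (joint x y z w)"
    and one_nonzero_joint: "\<not> same_event x y z w \<Longrightarrow> one_nonzero (joint x y z w)"
    and odds_share_joint: "odds_share x y = 0 \<longleftrightarrow>
      joint x y z w$1$1 = 0 \<and> joint x y z w$2$2 = 0 \<or>
      joint x y z w$1$2 \<noteq> 0 \<and> joint x y z w$2$1 \<noteq> 0"
proof -
  have zw': "z \<in> {0..1}" "w \<in> {0..1}" using zw by (auto simp: on_side_def)
  note zeros = joint_zeros[OF xy zw'] and eq' = eq[unfolded odds_share_side[OF xy] odds_share_side[OF zw]]
  let ?goal = "(same_event x y z w \<longrightarrow> one_zero (joint x y z w)) \<and>
    (\<not> same_event x y z w \<longrightarrow> one_nonzero (joint x y z w)) \<and>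
    (odds_share x y = 0 \<longleftrightarrow>
      joint x y z w$1$1 = 0 \<and> joint x y z w$2$2 = 0 \<or>
      joint x y z w$1$2 \<noteq> 0 \<and> joint x y z w$2$1 \<noteq> 0)"
  have ?goal
    using xy
  proof (cases rule: on_side_cases)
    case 1
    from zw show ?thesis
      unfolding one_zero_iff one_nonzero_iff same_event_def zeros odds_share_side[OF xy]
      by (cases rule: on_side_cases) (use eq' 1 in simp_all)
  next
    case 2
    from zw show ?thesis
      unfolding one_zero_iff one_nonzero_iff same_event_def zeros odds_share_side[OF xy]
      by (cases rule: on_side_cases) (use eq' 2 in simp_all)
  next
    case 3
    from zw show ?thesis
      unfolding one_zero_iff one_nonzero_iff same_event_def zeros odds_share_side[OF xy]
      by (cases rule: on_side_cases) (use eq' 3 in simp_all)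
  next
    case 4
    from zw show ?thesis
      unfolding one_zero_iff one_nonzero_iff same_event_def zeros odds_share_side[OF xy]
      by (cases rule: on_side_cases) (use eq' 4 in simp_all)
  qed
  then show "same_event x y z w \<Longrightarrow> one_zero (joint x y z w)"
    and "\<not> same_event x y z w \<Longrightarrow> one_nonzero (joint x y z w)"
    and "odds_share x y = 0 \<longleftrightarrow>
      joint x y z w$1$1 = 0 \<and> joint x y z w$2$2 = 0 \<or>
      joint x y z w$1$2 \<noteq> 0 \<and> joint x y z w$2$1 \<noteq> 0" by blast+
qed

lemma one_zero_not_one_nonzero: "one_zero P \<Longrightarrow> \<not> one_nonzero P"
  by (auto simp: one_zero_iff one_nonzero_iff)

section \<open>Kinds of arcs\<close>

lemma open_arc_between_sym: "open_arc_between C u v \<longleftrightarrow> open_arc_between C v u"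
proof -
  have "open_arc_between C v u" if arc: "open_arc_between C u v" for u v
  proof -
    obtain g where g: "arc g" "pathstart g = u" "pathfinish g = v" "g ` {0<..<1} = C"
      and uv: "u \<in> rel_frontier open_simplex" "v \<in> rel_frontier open_simplex"
      using arc unfolding open_arc_between_def by blast
    have "(\<lambda>t. 1 - t) ` {0<..<1} = {0<..<1 :: real}"
      by (auto simp: image_iff intro!: bexI[of _ "1 - _"])
    then have "g ` (\<lambda>t. 1 - t) ` {0<..<1} = C" by (simp only: g(4))
    then have "reversepath g ` {0<..<1} = C"
      unfolding reversepath_def image_image .
    then show ?thesis using g uv unfolding open_arc_between_def
      by (intro conjI exI[of _ "reversepath g"]) (simp_all add: arc_reversepath)
  qed
  then show ?thesis by blast
qed

definition opposite_kinds :: "game \<Rightarrow> real^2^2 \<Rightarrow> real^2^2 \<Rightarrow> bool" where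
  "opposite_kinds X u v \<longleftrightarrow> u \<noteq> v \<and> (is_E u \<and> is_F X v \<or> is_F X u \<and> is_E v)"

lemma EF_arc_if_opposite_kinds:
  assumes "open_arc_between C u v" "opposite_kinds X u v"
  shows "EF_arc X C"
proof -
  have "open_arc_between C v u" using assms(1) by (rule open_arc_between_sym[THEN iffD1])
  then show ?thesis using assms unfolding opposite_kinds_def EF_arc_def by blast
qed

text \<open>
  The facts about the end points of arcs that decide the kind of an arc. When \<open>\<phi>\<close> has equal values at 0
  and 1, the corners over these parameters and over the same end of \<open>\<gamma>\<close> are of opposite kinds.
\<close>

locale equilibrium_curve = matched_curve +
  fixes X :: game
  assumes corner_kind: "\<And>s t. s \<in> {0, 1} \<Longrightarrow> t \<in> {0, 1} \<Longrightarrow> \<phi> s = \<gamma> t \<Longrightarrow> is_E (\<Psi> s t) \<or> is_F X (\<Psi> s t)"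
    and corner_level: "\<And>s t s' t'. s \<in> {0, 1} \<Longrightarrow> t \<in> {0, 1} \<Longrightarrow> \<phi> s = \<gamma> t \<Longrightarrow>
      s' \<in> {0, 1} \<Longrightarrow> t' \<in> {0, 1} \<Longrightarrow> \<phi> s' = \<gamma> t' \<Longrightarrow> \<phi> s \<noteq> \<phi> s' \<Longrightarrow> \<Psi> s t \<noteq> \<Psi> s' t'"
    and \<phi>_alternates: "\<And>t. t \<in> {0, 1} \<Longrightarrow> \<phi> 0 = \<gamma> t \<Longrightarrow> \<phi> 1 = \<gamma> t \<Longrightarrow> opposite_kinds X (\<Psi> 0 t) (\<Psi> 1 t)"
    and \<gamma>_alternates: "\<And>s. s \<in> {0, 1} \<Longrightarrow> \<phi> s = \<gamma> 0 \<Longrightarrow> \<phi> s = \<gamma> 1 \<Longrightarrow> opposite_kinds X (\<Psi> s 0) (\<Psi> s 1)"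
begin

lemma flip_equilibrium: "equilibrium_curve \<gamma> \<phi> (\<lambda>s t. \<Psi> t s) \<tau> \<sigma> X"
proof (intro equilibrium_curve.intro equilibrium_curve_axioms.intro flip)
  show "is_E (\<Psi> t s) \<or> is_F X (\<Psi> t s)" if "s \<in> {0, 1}" "t \<in> {0, 1}" "\<gamma> s = \<phi> t" for s t
    by (rule corner_kind[OF that(2,1) that(3)[symmetric]])
  show "\<Psi> t s \<noteq> \<Psi> t' s'" if "s \<in> {0, 1}" "t \<in> {0, 1}" "\<gamma> s = \<phi> t"
    "s' \<in> {0, 1}" "t' \<in> {0, 1}" "\<gamma> s' = \<phi> t'" "\<gamma> s \<noteq> \<gamma> s'" for s t s' t'
    by (rule corner_level[OF that(2,1) that(3)[symmetric] that(5,4) that(6)[symmetric] that(7)[unfolded that(3,6)]])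
  show "opposite_kinds X (\<Psi> t 0) (\<Psi> t 1)" if "t \<in> {0, 1}" "\<gamma> 0 = \<phi> t" "\<gamma> 1 = \<phi> t" for t
    by (rule \<gamma>_alternates[OF that(1) that(2,3)[symmetric]])
  show "opposite_kinds X (\<Psi> 0 s) (\<Psi> 1 s)" if "s \<in> {0, 1}" "\<gamma> s = \<phi> 0" "\<gamma> s = \<phi> 1" for s
    by (rule \<phi>_alternates[OF that(1) that(2,3)[symmetric]])
qed

text \<open>
  When \<open>\<gamma>\<close> is a bijection, the curve is a graph over \<open>s\<close>. If \<open>\<phi>\<close> has equal values at its ends, then both
  ends of the graph lie over the same end of \<open>\<gamma>\<close>, and the kinds alternate. If not, the odds ratios at the
  ends of the graph differ, which is why its two end points are distinct.
\<close>

lemma crossing_component: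
  assumes "inj_on \<gamma> {0..1}" "\<gamma> 0 \<noteq> \<gamma> 1"
  shows "components (piece UNIV) = {piece UNIV}"
    "\<phi> 0 = \<phi> 1 \<Longrightarrow> EF_arc X (piece UNIV)"
    "\<phi> 0 \<noteq> \<phi> 1 \<Longrightarrow> EE_arc (piece UNIV) \<or> EF_arc X (piece UNIV) \<or> FF_arc X (piece UNIV)"
proof -
  show "components (piece UNIV) = {piece UNIV}" by (rule one_branch(2)[OF assms])
  from one_branch(1)[OF assms] obtain t0 t1 where t01: "t0 \<in> {0, 1}" "t1 \<in> {0, 1}"
    and *: "\<gamma> t0 = \<phi> 0 \<and> \<gamma> t1 = \<phi> 1 \<and>
      (\<Psi> 0 t0 \<noteq> \<Psi> 1 t1 \<longrightarrow> open_arc_between (piece UNIV) (\<Psi> 0 t0) (\<Psi> 1 t1))"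
    by (elim bexE)
  note t = t01 *[THEN conjunct1] *[THEN conjunct2, THEN conjunct1]
  note arc = *[THEN conjunct2, THEN conjunct2, THEN mp]
  show "EF_arc X (piece UNIV)" if "\<phi> 0 = \<phi> 1"
  proof -
    have "\<gamma> t1 = \<gamma> t0" unfolding t(3,4) by (rule that[symmetric])
    then have "t1 = t0" by (rule inj_onD[OF assms(1)]) (use t(1,2) in auto)
    moreover have "\<phi> 1 = \<gamma> t0" unfolding t(3) by (rule that[symmetric])
    ultimately have "opposite_kinds X (\<Psi> 0 t0) (\<Psi> 1 t1)"
      using \<phi>_alternates[OF t(1) t(3)[symmetric]] by blast
    moreover from this have "\<Psi> 0 t0 \<noteq> \<Psi> 1 t1" by (simp add: opposite_kinds_def)
    ultimately show ?thesis using EF_arc_if_opposite_kinds[OF arc] by simp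
  qed
  show "EE_arc (piece UNIV) \<or> EF_arc X (piece UNIV) \<or> FF_arc X (piece UNIV)" if "\<phi> 0 \<noteq> \<phi> 1"
  proof -
    have ne: "\<Psi> 0 t0 \<noteq> \<Psi> 1 t1"
      by (rule corner_level[OF _ t(1) t(3)[symmetric] _ t(2) t(4)[symmetric] that]) simp_all
    have "is_E (\<Psi> 0 t0) \<or> is_F X (\<Psi> 0 t0)" "is_E (\<Psi> 1 t1) \<or> is_F X (\<Psi> 1 t1)"
      by (rule corner_kind[OF _ t(1) t(3)[symmetric]] corner_kind[OF _ t(2) t(4)[symmetric]], simp)+
    then consider "is_E (\<Psi> 0 t0)" "is_E (\<Psi> 1 t1)" | "is_F X (\<Psi> 0 t0)" "is_F X (\<Psi> 1 t1)"
      | "opposite_kinds X (\<Psi> 0 t0) (\<Psi> 1 t1)" using ne unfolding opposite_kinds_def by blast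
    then show ?thesis
    proof cases
      case 3
      then show ?thesis using EF_arc_if_opposite_kinds[OF arc[OF ne]] by simp
    next
      case 1
      then have "EE_arc (piece UNIV)" unfolding EE_arc_def using arc[OF ne] by (intro exI conjI)
      then show ?thesis by blast
    next
      case 2
      then have "FF_arc X (piece UNIV)" unfolding FF_arc_def using arc[OF ne] by (intro exI conjI)
      then show ?thesis by blast
    qed
  qed
qed

lemma nested_fold_components:
  assumes c: "c \<in> {0<..<1}" "inj_on \<gamma> {0..c}" "inj_on \<gamma> {c..1}" and ends: "\<gamma> 0 = \<gamma> 1" "\<phi> 0 = \<phi> 1" "\<phi> 0 = \<gamma> 0"
    and onto: "\<phi> ` {0..1} \<subseteq> closed_segment (\<gamma> 0) (\<gamma> c) - {\<gamma> c}"
  shows "\<exists>A B. A \<noteq> B \<and> components (piece UNIV) = {A, B} \<and> EF_arc X A \<and> EF_arc X B"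
proof -
  note br = two_branches[OF c ends(1) onto]
  have "opposite_kinds X (\<Psi> 0 0) (\<Psi> 1 0)" "opposite_kinds X (\<Psi> 0 1) (\<Psi> 1 1)"
    by (rule \<phi>_alternates; use ends in simp)+
  then have "EF_arc X (piece {0..c})" "EF_arc X (piece {c..1})"
    using EF_arc_if_opposite_kinds[OF br(3)] EF_arc_if_opposite_kinds[OF br(4)]
    by (simp_all add: opposite_kinds_def)
  then show ?thesis using br(1,2) by blast
qed

text \<open>
  Both images are segments that start at the same point of \<open>{0, 1}\<close> and have different ends in \<open>(0, 1)\<close>, so one
  is contained in the other without its end.
\<close>

lemma fold_components:
  assumes c: "c \<in> {0<..<1}" "inj_on \<gamma> {0..c}" "inj_on \<gamma> {c..1}"
    and d: "d \<in> {0<..<1}" "inj_on \<phi> {0..d}" "inj_on \<phi> {d..1}"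
    and ends: "\<gamma> 0 = \<gamma> 1" "\<phi> 0 = \<phi> 1" "\<phi> 0 = \<gamma> 0"
    and differ: "\<phi> d \<noteq> \<gamma> c"
  shows "\<exists>A B. A \<noteq> B \<and> components (piece UNIV) = {A, B} \<and> EF_arc X A \<and> EF_arc X B"
proof -
  interpret flip: equilibrium_curve \<gamma> \<phi> "\<lambda>s t. \<Psi> t s" \<tau> \<sigma> X by (rule flip_equilibrium)
  have img: "\<gamma> ` {0..1} = closed_segment (\<gamma> 0) (\<gamma> c)" "\<phi> ` {0..1} = closed_segment (\<gamma> 0) (\<phi> d)"
    using fold_image[OF c ends(1)] flip.fold_image[OF d ends(2)] ends(3) by simp_all
  have int: "\<gamma> c \<in> {0<..<1}" "\<phi> d \<in> {0<..<1}" "\<gamma> 0 \<in> {0, 1}"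
    using c(1) d(1) \<gamma>_interior \<phi>_interior \<gamma>_ends by blast+
  have seg: "closed_segment e p \<subseteq> closed_segment e q - {q} \<or> closed_segment e q \<subseteq> closed_segment e p - {p}"
    if "p \<in> {0<..<1}" "q \<in> {0<..<1}" "e \<in> {0, 1}" "p \<noteq> q" for e p q :: real
  proof -
    have "e = 0 \<or> e = 1" using that(3) by simp
    then show ?thesis
      using that by (elim disjE; cases "p < q") (auto simp: closed_segment_eq_real_ivl subset_iff)
  qed
  consider "\<phi> ` {0..1} \<subseteq> closed_segment (\<gamma> 0) (\<gamma> c) - {\<gamma> c}"
    | "\<gamma> ` {0..1} \<subseteq> closed_segment (\<phi> 0) (\<phi> d) - {\<phi> d}"
    using seg[OF int(2,1,3) differ] unfolding img ends(3) by blast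
  then show ?thesis
  proof cases
    case 1
    show ?thesis by (rule nested_fold_components[OF c ends 1])
  next
    case 2
    have "\<gamma> 0 = \<phi> 0" using ends(3) by simp
    from flip.nested_fold_components[OF d ends(2,1) this 2] show ?thesis
      unfolding piece_flip .
  qed
qed

lemma crossing_component_flip:
  assumes "inj_on \<phi> {0..1}" "\<phi> 0 \<noteq> \<phi> 1" "\<gamma> 0 = \<gamma> 1"
  shows "components (piece UNIV) = {piece UNIV}" "EF_arc X (piece UNIV)"
proof -
  interpret flip: equilibrium_curve \<gamma> \<phi> "\<lambda>s t. \<Psi> t s" \<tau> \<sigma> X by (rule flip_equilibrium)
  show "components (piece UNIV) = {piece UNIV}" "EF_arc X (piece UNIV)"
    using flip.crossing_component(1,2)[OF assms(1,2)] assms(3) unfolding piece_flip by simp_all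
qed

end

section \<open>The curve of dependency equilibria\<close>

lemma along_side:
  assumes "chord x0 y0 x1 y1" "s \<in> {0, 1}"
  shows "on_side (along x0 x1 s) (along y0 y1 s)"
  using assms by (auto simp: chord_def)

lemma no_ties_transpose [simp]: "no_ties (transpose b) \<longleftrightarrow> no_ties b"
  by (auto simp: no_ties_def transpose_def)

lemma corner_joint:
  assumes ties: "no_ties (fst X)" "no_ties (snd X)"
    and side: "on_side x y" "on_side z w" and eq: "odds_share x y = odds_share z w"
    and gain: "payoff_gap (fst X) x y = 0" "payoff_gap (transpose (snd X)) z w = 0"
  shows "same_event x y z w \<Longrightarrow> one_zero (joint x y z w) \<and> is_F X (joint x y z w)"
    and "\<not> same_event x y z w \<Longrightarrow> one_nonzero (joint x y z w) \<and> is_E (joint x y z w)"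
    and "joint x y z w \<notin> open_simplex"
proof -
  have xy: "x \<in> {0..1}" "y \<in> {0..1}" "x \<in> {0<..<1} \<or> y \<in> {0<..<1}"
    and zw: "z \<in> {0..1}" "w \<in> {0..1}" "z \<in> {0<..<1} \<or> w \<in> {0<..<1}"
    using side by (auto simp: on_side_def)
  have "same_odds x y z w"
    using same_odds_iff_odds_share[OF odds_denominator_pos[OF xy] odds_denominator_pos[OF zw]] eq by simp
  note det = joint_on_variety[OF this gain]
  show F: "one_zero (joint x y z w) \<and> is_F X (joint x y z w)" if "same_event x y z w"
    using one_zero_joint[OF side eq that] is_F_if_one_zero[OF ties det] by simp
  show E: "one_nonzero (joint x y z w) \<and> is_E (joint x y z w)" if "\<not> same_event x y z w"
    using one_nonzero_joint[OF side eq that] by (simp add: is_E_iff_one_nonzero)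
  show "joint x y z w \<notin> open_simplex"
  proof (cases "same_event x y z w")
    case True
    from one_zero_joint[OF side eq this] show ?thesis unfolding one_zero_iff open_simplex_iff by linarith
  next
    case False
    from one_nonzero_joint[OF side eq this] show ?thesis unfolding one_nonzero_iff open_simplex_iff by linarith
  qed
qed

lemma same_event_iff:
  assumes "on_side x y" "on_side z w" "odds_share x y = odds_share z w"
  shows "same_event x y z w \<longleftrightarrow> (if x = 0 \<or> y = 1 then x = 0 \<longleftrightarrow> z = 0 else x = 1 \<longleftrightarrow> w = 0)"
proof -
  have level: "x = 0 \<or> y = 1 \<longleftrightarrow> z = 0 \<or> w = 1"
    using assms(3) odds_share_side[OF assms(1)] odds_share_side[OF assms(2)] by (simp split: if_splits)
  from assms(1) show ?thesis
  proof (cases rule: on_side_cases)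
    case 1
    from assms(2) show ?thesis by (cases rule: on_side_cases) (use 1 level in \<open>simp_all add: same_event_def\<close>)
  next
    case 2
    from assms(2) show ?thesis by (cases rule: on_side_cases) (use 2 level in \<open>simp_all add: same_event_def\<close>)
  next
    case 3
    from assms(2) show ?thesis by (cases rule: on_side_cases) (use 3 level in \<open>simp_all add: same_event_def\<close>)
  next
    case 4
    from assms(2) show ?thesis by (cases rule: on_side_cases) (use 4 level in \<open>simp_all add: same_event_def\<close>)
  qed
qed

text \<open>
  The sides with odds ratio 0 are \<open>x = 0\<close> and \<open>y = 1\<close>, and the points \<open>(x, y)\<close> and \<open>(x', y')\<close> lie on different
  ones among them (or among the two sides with odds ratio \<open>\<infinity>\<close>). The point \<open>(z, w)\<close> singles out the same
  entry as exactly one of them.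
\<close>

lemma same_event_alternates:
  assumes "on_side x y" "on_side x' y'" "x \<noteq> x'" "y \<noteq> y'" "on_side z w"
    and "odds_share x y = odds_share z w" "odds_share x' y' = odds_share z w"
  shows "same_event x y z w \<longleftrightarrow> \<not> same_event x' y' z w"
proof -
  have level: "x = 0 \<or> y = 1 \<longleftrightarrow> x' = 0 \<or> y' = 1"
    using assms(6,7) odds_share_side[OF assms(1)] odds_share_side[OF assms(2)] by (simp split: if_splits)
  have "(if x = 0 \<or> y = 1 then x = 0 \<longleftrightarrow> x' \<noteq> 0 else x = 1 \<longleftrightarrow> x' \<noteq> 1)"
    using assms(1)
  proof (cases rule: on_side_cases)
    case 1
    from assms(2) show ?thesis by (cases rule: on_side_cases) (use 1 level assms(3,4) in simp_all)
  next
    case 2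
    from assms(2) show ?thesis by (cases rule: on_side_cases) (use 2 level assms(3,4) in simp_all)
  next
    case 3
    from assms(2) show ?thesis by (cases rule: on_side_cases) (use 3 level assms(3,4) in simp_all)
  next
    case 4
    from assms(2) show ?thesis by (cases rule: on_side_cases) (use 4 level assms(3,4) in simp_all)
  qed
  then show ?thesis
    unfolding same_event_iff[OF assms(1,5,6)] same_event_iff[OF assms(2,5,7)] level
    by (cases "x' = 0 \<or> y' = 1") (simp only: if_True if_False, argo)+
qed

lemma opposite_kinds_corners:
  assumes "no_ties (fst X)" "no_ties (snd X)"
    and "on_side x y" "on_side z w" "odds_share x y = odds_share z w"
    and "payoff_gap (fst X) x y = 0" "payoff_gap (transpose (snd X)) z w = 0"
    and "on_side x' y'" "on_side z' w'" "odds_share x' y' = odds_share z' w'"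
    and "payoff_gap (fst X) x' y' = 0" "payoff_gap (transpose (snd X)) z' w' = 0"
    and "same_event x y z w \<longleftrightarrow> \<not> same_event x' y' z' w'"
  shows "opposite_kinds X (joint x y z w) (joint x' y' z' w')"
proof -
  note c = corner_joint(1,2)[OF assms(1-7)] and c' = corner_joint(1,2)[OF assms(1,2,8-12)]
  show ?thesis
  proof (cases "same_event x y z w")
    case True
    then have "\<not> same_event x' y' z' w'" using assms(13) by simp
    from c(1)[OF True] c'(2)[OF this] one_zero_not_one_nonzero[of "joint x y z w"]
    show ?thesis unfolding opposite_kinds_def by metis
  next
    case False
    then have "same_event x' y' z' w'" using assms(13) by simp
    from c(2)[OF False] c'(1)[OF this] one_zero_not_one_nonzero[of "joint x y z w"]
    show ?thesis unfolding opposite_kinds_def by metis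
  qed
qed

lemma same_event_commute: "same_event x y z w \<longleftrightarrow> same_event z w x y"
  by (auto simp: same_event_def)

locale two_chords =
  fixes X :: game and x0 y0 x1 y1 z0 w0 z1 w1 :: real
  assumes ties: "no_ties (fst X)" "no_ties (snd X)"
    and rows: "indifference_chord (fst X) x0 y0 x1 y1"
    and columns: "indifference_chord (transpose (snd X)) z0 w0 z1 w1"
begin

abbreviation (input) joint_at :: "real \<Rightarrow> real \<Rightarrow> real^2^2" where
  "joint_at s t \<equiv> joint (along x0 x1 s) (along y0 y1 s) (along z0 z1 t) (along w0 w1 t)"

lemma chords: "chord x0 y0 x1 y1" "chord z0 w0 z1 w1"
  using rows columns by (simp_all add: indifference_chord_def)

lemma gains: "payoff_gap (fst X) (along x0 x1 s) (along y0 y1 s) = 0"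
    "payoff_gap (transpose (snd X)) (along z0 z1 t) (along w0 w1 t) = 0"
  using rows columns by (simp_all add: indifference_chord_def)

lemma same_odds_chords:
  assumes "s \<in> {0..1}" "t \<in> {0..1}"
  shows "same_odds (along x0 x1 s) (along y0 y1 s) (along z0 z1 t) (along w0 w1 t)
    \<longleftrightarrow> chord_share x0 y0 x1 y1 s = chord_share z0 w0 z1 w1 t"
  unfolding chord_share_def
  by (rule same_odds_iff_odds_share[OF odds_denominator_pos[OF chord_closed[OF chords(1) assms(1)]]
        odds_denominator_pos[OF chord_closed[OF chords(2) assms(2)]]])

lemma chord_ends: "on_side x0 y0" "on_side x1 y1" "x0 \<noteq> x1" "y0 \<noteq> y1"
    "on_side z0 w0" "on_side z1 w1" "z0 \<noteq> z1" "w0 \<noteq> w1"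
  using chords by (simp_all add: chord_def)

text \<open>
  The parameters are recovered from the conditional probabilities \<open>x\<close> and \<open>z\<close>, which are injective affine
  functions of them.
\<close>

sublocale equilibrium_curve "chord_share x0 y0 x1 y1" "chord_share z0 w0 z1 w1" joint_at
  "\<lambda>P. (P$1$1 / (P$1$1 + P$1$2) - x0) / (x1 - x0)" "\<lambda>P. (P$1$1 / (P$1$1 + P$2$1) - z0) / (z1 - z0)" X
proof
  show "continuous_on {0..1} (chord_share x0 y0 x1 y1)" "continuous_on {0..1} (chord_share z0 w0 z1 w1)"
    using continuous_on_chord_share chords by blast+
  show "chord_share x0 y0 x1 y1 s \<in> {0<..<1}" "chord_share z0 w0 z1 w1 s \<in> {0<..<1}"
    if "s \<in> {0<..<1}" for s
    using chord_share_interior chords that by blast+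
  have ends: "chord_share u0 v0 u1 v1 s \<in> {0, 1}" if "chord u0 v0 u1 v1" "s \<in> {0, 1}" for u0 v0 u1 v1 s
    using odds_share_side[OF along_side[OF that]] by (simp add: chord_share_def)
  show "chord_share x0 y0 x1 y1 0 \<in> {0, 1}" "chord_share x0 y0 x1 y1 1 \<in> {0, 1}"
    "chord_share z0 w0 z1 w1 0 \<in> {0, 1}" "chord_share z0 w0 z1 w1 1 \<in> {0, 1}"
    by (rule ends[OF chords(1)] ends[OF chords(2)]; simp)+
  show "continuous_on ({0..1} \<times> {0..1}) (\<lambda>(s, t). joint_at s t)"
    unfolding split_def
  proof (rule continuous_on_joint)
    fix p :: "real \<times> real" assume "p \<in> {0..1} \<times> {0..1}"
    then have p: "fst p \<in> {0..1}" "snd p \<in> {0..1}" by auto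
    note c = chord_closed[OF chords(1) p(1)] and d = chord_closed[OF chords(2) p(2)]
    show "along z0 z1 (snd p) * along y0 y1 (fst p) + along w0 w1 (snd p) * (1 - along y0 y1 (fst p)) +
       ((1 - along z0 z1 (snd p)) * along x0 x1 (fst p) + (1 - along w0 w1 (snd p)) * (1 - along x0 x1 (fst p))) \<noteq> 0"
      using joint_denominator_pos[OF c(1,2) d(1,2) c(3)] by simp
  qed (auto simp: along_def intro!: continuous_intros)
  show "joint_at s t \<in> open_simplex" if "s \<in> {0<..<1}" "t \<in> {0<..<1}" for s t
    by (intro joint_in_open_simplex chord_interior[OF chords(1)] chord_interior[OF chords(2)] that)
  fix s t :: real
  {
    assume st: "s \<in> {0<..<1}" "t \<in> {0<..<1}" "chord_share x0 y0 x1 y1 s = chord_share z0 w0 z1 w1 t"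
    have "same_odds (along x0 x1 s) (along y0 y1 s) (along z0 z1 t) (along w0 w1 t)"
      using st by (subst same_odds_chords) auto
    note c = joint_conditionals[OF chord_interior[OF chords(1) st(1)] chord_interior[OF chords(2) st(2)] this]
    have "x0 \<noteq> x1" "z0 \<noteq> z1" using chords by (auto simp: chord_def)
    moreover have "along x0 x1 s - x0 = s * (x1 - x0)" "along z0 z1 t - z0 = t * (z1 - z0)"
      by (simp_all add: along_def algebra_simps)
    ultimately show "(joint_at s t $1$1 / (joint_at s t $1$1 + joint_at s t $1$2) - x0) / (x1 - x0) = s \<and>
      (joint_at s t $1$1 / (joint_at s t $1$1 + joint_at s t $2$1) - z0) / (z1 - z0) = t"
      unfolding c by simp
  }
  have pos: "P$1$1 + P$1$2 \<noteq> 0" "P$1$1 + P$2$1 \<noteq> 0" if "P \<in> open_simplex" for P :: "real^2^2"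
    using that by (auto simp: open_simplex_iff)
  have ne: "x1 - x0 \<noteq> 0" "z1 - z0 \<noteq> 0" using chords by (auto simp: chord_def)
  show "continuous_on open_simplex (\<lambda>P. (P$1$1 / (P$1$1 + P$1$2) - x0) / (x1 - x0))"
    "continuous_on open_simplex (\<lambda>P. (P$1$1 / (P$1$1 + P$2$1) - z0) / (z1 - z0))"
    by (intro continuous_intros ballI pos ne; assumption)+
  {
    assume st: "s \<in> {0, 1}" "t \<in> {0, 1}" "chord_share x0 y0 x1 y1 s = chord_share z0 w0 z1 w1 t"
    note c = corner_joint[OF ties along_side[OF chords(1) st(1)] along_side[OF chords(2) st(2)]
        st(3)[unfolded chord_share_def] gains]
    show "joint_at s t \<notin> open_simplex" by (rule c(3))
    show "is_E (joint_at s t) \<or> is_F X (joint_at s t)" using c(1,2) by blast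
  }
  {
    fix s' t' :: real
    assume st: "s \<in> {0, 1}" "t \<in> {0, 1}" "chord_share x0 y0 x1 y1 s = chord_share z0 w0 z1 w1 t"
      "s' \<in> {0, 1}" "t' \<in> {0, 1}" "chord_share x0 y0 x1 y1 s' = chord_share z0 w0 z1 w1 t'"
      "chord_share x0 y0 x1 y1 s \<noteq> chord_share x0 y0 x1 y1 s'"
    note c = odds_share_joint[OF along_side[OF chords(1) st(1)] along_side[OF chords(2) st(2)]
        st(3)[unfolded chord_share_def], folded chord_share_def]
    note c' = odds_share_joint[OF along_side[OF chords(1) st(4)] along_side[OF chords(2) st(5)]
        st(6)[unfolded chord_share_def], folded chord_share_def]
    show "joint_at s t \<noteq> joint_at s' t'"
    proof
      assume "joint_at s t = joint_at s' t'"
      then have "chord_share x0 y0 x1 y1 s = 0 \<longleftrightarrow> chord_share x0 y0 x1 y1 s' = 0"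
        unfolding c c' by simp
      then show False using ends[OF chords(1) st(1)] ends[OF chords(1) st(4)] st(7) by auto
    qed
  }
  show "opposite_kinds X (joint_at 0 t) (joint_at 1 t)"
    if t: "t \<in> {0, 1}" and eq: "chord_share x0 y0 x1 y1 0 = chord_share z0 w0 z1 w1 t"
      "chord_share x0 y0 x1 y1 1 = chord_share z0 w0 z1 w1 t"
  proof (rule opposite_kinds_corners[OF ties])
    show "same_event (along x0 x1 0) (along y0 y1 0) (along z0 z1 t) (along w0 w1 t) \<longleftrightarrow>
      \<not> same_event (along x0 x1 1) (along y0 y1 1) (along z0 z1 t) (along w0 w1 t)"
      by (rule same_event_alternates)
       (use eq chord_ends along_side[OF chords(2) t] in \<open>simp_all add: chord_share_def\<close>)
  qed (use eq gains chord_ends gains[of 0] gains[of 1] along_side[OF chords(2) t] in \<open>simp_all add: chord_share_def\<close>)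
  show "opposite_kinds X (joint_at s 0) (joint_at s 1)"
    if s: "s \<in> {0, 1}" and eq: "chord_share x0 y0 x1 y1 s = chord_share z0 w0 z1 w1 0"
      "chord_share x0 y0 x1 y1 s = chord_share z0 w0 z1 w1 1"
  proof (rule opposite_kinds_corners[OF ties])
    show "same_event (along x0 x1 s) (along y0 y1 s) (along z0 z1 0) (along w0 w1 0) \<longleftrightarrow>
      \<not> same_event (along x0 x1 s) (along y0 y1 s) (along z0 z1 1) (along w0 w1 1)"
      unfolding same_event_commute[of "along x0 x1 s"]
      by (rule same_event_alternates)
       (use eq chord_ends along_side[OF chords(1) s] in \<open>simp_all add: chord_share_def\<close>)
  qed (use eq gains chord_ends gains[of 0] gains[of 1] along_side[OF chords(1) s] in \<open>simp_all add: chord_share_def\<close>)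
qed

lemma piece_eq: "piece UNIV = dependency_equilibria X"
proof (intro equalityI subsetI)
  fix P assume "P \<in> piece UNIV"
  then obtain s t where st: "s \<in> {0<..<1}" "t \<in> {0<..<1}"
    "chord_share x0 y0 x1 y1 s = chord_share z0 w0 z1 w1 t" "P = joint_at s t"
    unfolding piece_def by blast
  have "same_odds (along x0 x1 s) (along y0 y1 s) (along z0 z1 t) (along w0 w1 t)"
    using st(1-3) by (subst same_odds_chords) auto
  with chord_interior[OF chords(1) st(1)] chord_interior[OF chords(2) st(2)] gains st(4)
  show "P \<in> dependency_equilibria X" unfolding dependency_equilibria_iff by blast
next
  fix P assume "P \<in> dependency_equilibria X"
  then obtain x y z w where *: "x \<in> {0<..<1}" "y \<in> {0<..<1}" "z \<in> {0<..<1}" "w \<in> {0<..<1}"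
     "same_odds x y z w" "payoff_gap (fst X) x y = 0" "payoff_gap (transpose (snd X)) z w = 0"
     "P = joint x y z w" unfolding dependency_equilibria_iff by blast
  obtain s where s: "s \<in> {0<..<1}" "x = along x0 x1 s" "y = along y0 y1 s"
    using rows *(1,2,6) unfolding indifference_chord_def by blast
  obtain t where t: "t \<in> {0<..<1}" "z = along z0 z1 t" "w = along w0 w1 t"
    using columns *(3,4,7) unfolding indifference_chord_def by blast
  have "chord_share x0 y0 x1 y1 s = chord_share z0 w0 z1 w1 t"
    using *(5) s(1) t(1) unfolding s t by (subst (asm) same_odds_chords) auto
  then show "P \<in> piece UNIV" unfolding piece_def *(8) s t using s(1) t(1) by blast
qed

end

section \<open>Generic games\<close>

lemma sign_condition_iff: "sign_condition X \<longleftrightarrow> crosses (fst X) \<and> crosses (transpose (snd X))"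
  by (simp add: sign_condition_def crosses_def Let_def transpose_def)

definition generic :: "game \<Rightarrow> bool" where
  "generic X \<longleftrightarrow> no_ties (fst X) \<and> no_ties (snd X) \<and>
     resultant (tangency_form (fst X)) (tangency_form (transpose (snd X))) \<noteq> 0"

text \<open>
  The relation \<open>R\<close> is either trivial or \<open><\<close>; in the second case the point has to lie above the diagonal, where
  the odds ratio is less than 1.
\<close>

definition indifference_meets :: "real^2^2 \<Rightarrow> (real \<Rightarrow> real \<Rightarrow> bool) \<Rightarrow> bool" where
  "indifference_meets a R \<longleftrightarrow> (\<exists>x\<in>{0<..<1}. \<exists>y\<in>{0<..<1}. payoff_gap a x y = 0 \<and> R x y)"

lemma indifference_chord_exists:
  assumes "no_ties a" "indifference_meets a R"
  obtains x0 y0 x1 y1 where "indifference_chord a x0 y0 x1 y1"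
      "crosses a \<longleftrightarrow> odds_share x0 y0 \<noteq> odds_share x1 y1"
  using assms(1)
proof (cases rule: indifference_chord_cases)
  case miss
  then show ?thesis using assms(2) by (auto simp: indifference_meets_def)
qed (use that in blast)

lemma indifference_meets_if_crosses:
  assumes "no_ties a" "crosses a"
  shows "indifference_meets a (\<lambda>_ _. True)"
  using assms(1)
proof (cases rule: indifference_chord_cases)
  case miss
  then show ?thesis using assms(2) by blast
next
  case (hit x0 y0 x1 y1)
  then have "chord x0 y0 x1 y1" "payoff_gap a (along x0 x1 (1/2)) (along y0 y1 (1/2)) = 0"
    by (auto simp: indifference_chord_def)
  with chord_interior[of x0 y0 x1 y1 "1/2"] show ?thesis
    unfolding indifference_meets_def
    by (intro bexI[of _ "along x0 x1 (1/2)"] bexI[of _ "along y0 y1 (1/2)"]) auto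
qed

lemma no_equilibria:
  assumes "\<not> indifference_meets (fst X) (\<lambda>_ _. True) \<or> \<not> indifference_meets (transpose (snd X)) (\<lambda>_ _. True)"
  shows "dependency_equilibria X = {}"
  using assms unfolding indifference_meets_def dependency_equilibria_iff set_eq_iff by blast

lemma chord_share_ends: "chord_share x0 y0 x1 y1 0 = odds_share x0 y0" "chord_share x0 y0 x1 y1 1 = odds_share x1 y1"
  by (simp_all add: chord_share_def)

lemma components_both_cross:
  assumes "generic X" "crosses (fst X)" "crosses (transpose (snd X))"
  shows "\<exists>C. components (dependency_equilibria X) = {C} \<and> (EE_arc C \<or> EF_arc X C \<or> FF_arc X C)"
proof -
  have ties: "no_ties (fst X)" "no_ties (snd X)" using assms(1) by (auto simp: generic_def)
  have ties': "no_ties (transpose (snd X))" using ties(2) by simp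
  obtain x0 y0 x1 y1 where a: "indifference_chord (fst X) x0 y0 x1 y1"
      "crosses (fst X) \<longleftrightarrow> odds_share x0 y0 \<noteq> odds_share x1 y1"
    by (rule indifference_chord_exists[OF ties(1) indifference_meets_if_crosses[OF ties(1) assms(2)]])
  obtain z0 w0 z1 w1 where b: "indifference_chord (transpose (snd X)) z0 w0 z1 w1"
      "crosses (transpose (snd X)) \<longleftrightarrow> odds_share z0 w0 \<noteq> odds_share z1 w1"
    by (rule indifference_chord_exists[OF ties' indifference_meets_if_crosses[OF ties' assms(3)]])
  interpret two_chords X x0 y0 x1 y1 z0 w0 z1 w1
    by unfold_locales (fact ties a b)+
  have "inj_on (chord_share z0 w0 z1 w1) {0..1}"
    using b assms(3) by (intro chord_share_inj[OF chords(2)]) simp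
  moreover have "chord_share z0 w0 z1 w1 0 \<noteq> chord_share z0 w0 z1 w1 1"
    "chord_share x0 y0 x1 y1 0 \<noteq> chord_share x0 y0 x1 y1 1"
    using a(2) b(2) assms by (simp_all add: chord_share_ends)
  ultimately show ?thesis
    using crossing_component(1,3) unfolding piece_eq by blast
qed

lemma components_one_crosses:
  assumes "generic X" "crosses (fst X) \<longleftrightarrow> \<not> crosses (transpose (snd X))"
    and "indifference_meets (fst X) (\<lambda>_ _. True)" "indifference_meets (transpose (snd X)) (\<lambda>_ _. True)"
  shows "components (dependency_equilibria X) = {dependency_equilibria X}" "EF_arc X (dependency_equilibria X)"
proof -
  have ties: "no_ties (fst X)" "no_ties (snd X)" using assms(1) by (auto simp: generic_def)
  have ties': "no_ties (transpose (snd X))" using ties(2) by simp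
  obtain x0 y0 x1 y1 where a: "indifference_chord (fst X) x0 y0 x1 y1"
      "crosses (fst X) \<longleftrightarrow> odds_share x0 y0 \<noteq> odds_share x1 y1"
    by (rule indifference_chord_exists[OF ties(1) assms(3)])
  obtain z0 w0 z1 w1 where b: "indifference_chord (transpose (snd X)) z0 w0 z1 w1"
      "crosses (transpose (snd X)) \<longleftrightarrow> odds_share z0 w0 \<noteq> odds_share z1 w1"
    by (rule indifference_chord_exists[OF ties' assms(4)])
  interpret two_chords X x0 y0 x1 y1 z0 w0 z1 w1
    by unfold_locales (fact ties a b)+
  have "components (dependency_equilibria X) = {dependency_equilibria X} \<and> EF_arc X (dependency_equilibria X)"
  proof (cases "crosses (fst X)")
    case True
    have "inj_on (chord_share x0 y0 x1 y1) {0..1}"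
      using a(2) True by (intro chord_share_inj[OF chords(1)]) simp
    moreover have "chord_share x0 y0 x1 y1 0 \<noteq> chord_share x0 y0 x1 y1 1"
      "chord_share z0 w0 z1 w1 0 = chord_share z0 w0 z1 w1 1"
      using a(2) b(2) assms(2) True by (simp_all add: chord_share_ends)
    ultimately show ?thesis using crossing_component_flip unfolding piece_eq by blast
  next
    case False
    have "inj_on (chord_share z0 w0 z1 w1) {0..1}"
      using b(2) assms(2) False by (intro chord_share_inj[OF chords(2)]) simp
    moreover have "chord_share z0 w0 z1 w1 0 \<noteq> chord_share z0 w0 z1 w1 1"
      "chord_share x0 y0 x1 y1 0 = chord_share x0 y0 x1 y1 1"
      using a(2) b(2) assms(2) False by (simp_all add: chord_share_ends)
    ultimately show ?thesis using crossing_component(1,2) unfolding piece_eq by blast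
  qed
  then show "components (dependency_equilibria X) = {dependency_equilibria X}" "EF_arc X (dependency_equilibria X)"
    by blast+
qed

text \<open>
  Above the diagonal the odds share is less than 1/2, so the fold is the one that starts at 0.
\<close>

lemma odds_share_eq_0_if_meets_above:
  assumes ind: "indifference_chord a x0 y0 x1 y1" and eq: "odds_share x0 y0 = odds_share x1 y1"
  shows "indifference_meets a (<) \<Longrightarrow> odds_share x0 y0 = 0"
proof -
  assume "indifference_meets a (<)"
  then obtain x y where xy: "x \<in> {0<..<1}" "y \<in> {0<..<1}" "payoff_gap a x y = 0" "x < y"
    by (auto simp: indifference_meets_def)
  then obtain t where t: "t \<in> {0<..<1}" "x = along x0 x1 t" "y = along y0 y1 t"
    using ind unfolding indifference_chord_def by blast
  have ch: "chord x0 y0 x1 y1" using ind by (simp add: indifference_chord_def)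
  have t': "t \<in> {0..1}" using t(1) by auto
  have "chord_share x0 y0 x1 y1 t < 1 / 2"
    using odds_denominator_pos[OF chord_closed[OF ch t']] xy(4)
    unfolding chord_share_def odds_share_def t(2,3) by (simp add: field_simps)
  then show "odds_share x0 y0 = 0"
    using chord_share_half(2)[OF ch eq t'] odds_share_side[of x0 y0] ch
    by (auto simp: chord_def split: if_splits)
qed

text \<open>
  The two folds have to be on the same side of 1/2 for equilibria to exist. The second statement gives a
  way to see this for a concrete game: find on each line a point above the diagonal.
\<close>

lemma components_neither_crosses:
  assumes "generic X" "\<not> crosses (fst X)" "\<not> crosses (transpose (snd X))"
  shows "dependency_equilibria X = {} \<or>
      (\<exists>A B. A \<noteq> B \<and> components (dependency_equilibria X) = {A, B} \<and> EF_arc X A \<and> EF_arc X B)"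
    and "indifference_meets (fst X) (<) \<Longrightarrow> indifference_meets (transpose (snd X)) (<) \<Longrightarrow> dependency_equilibria X \<noteq> {}"
proof -
  have ties: "no_ties (fst X)" "no_ties (snd X)"
    and res: "resultant (tangency_form (fst X)) (tangency_form (transpose (snd X))) \<noteq> 0"
    using assms(1) by (auto simp: generic_def)
  have ties': "no_ties (transpose (snd X))" using ties(2) by simp
  let ?two = "\<exists>A B. A \<noteq> B \<and> components (dependency_equilibria X) = {A, B} \<and> EF_arc X A \<and> EF_arc X B"
  have "(dependency_equilibria X = {} \<or> ?two) \<and>
     (indifference_meets (fst X) (<) \<longrightarrow> indifference_meets (transpose (snd X)) (<) \<longrightarrow> ?two)"
  proof (cases "indifference_meets (fst X) (\<lambda>_ _. True) \<and> indifference_meets (transpose (snd X)) (\<lambda>_ _. True)")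
    case False
    then have "dependency_equilibria X = {}" using no_equilibria by blast
    moreover have "\<not> (indifference_meets (fst X) (<) \<and> indifference_meets (transpose (snd X)) (<))"
      using False by (auto simp: indifference_meets_def)
    ultimately show ?thesis by blast
  next
    case True
    obtain x0 y0 x1 y1 where a: "indifference_chord (fst X) x0 y0 x1 y1"
        "crosses (fst X) \<longleftrightarrow> odds_share x0 y0 \<noteq> odds_share x1 y1"
      by (rule indifference_chord_exists[OF ties(1) True[THEN conjunct1]])
    obtain z0 w0 z1 w1 where b: "indifference_chord (transpose (snd X)) z0 w0 z1 w1"
        "crosses (transpose (snd X)) \<longleftrightarrow> odds_share z0 w0 \<noteq> odds_share z1 w1"
      by (rule indifference_chord_exists[OF ties' True[THEN conjunct2]])
    interpret two_chords X x0 y0 x1 y1 z0 w0 z1 w1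
      by unfold_locales (fact ties a b)+
    have ea: "odds_share x0 y0 = odds_share x1 y1" and eb: "odds_share z0 w0 = odds_share z1 w1"
      using a(2) b(2) assms by simp_all
    show ?thesis
    proof (cases "odds_share x0 y0 = odds_share z0 w0")
      case same: True
      obtain d where d: "folds_at x0 y0 x1 y1 d" using chord_share_fold[OF chords(1) ea] by blast
      obtain c where c: "folds_at z0 w0 z1 w1 c" using chord_share_fold[OF chords(2) eb] by blast
      have "chord_share x0 y0 x1 y1 d \<noteq> chord_share z0 w0 z1 w1 c"
        by (rule fold_values_differ[OF ties(1) ties' a(1) b(1) d c res])
      with c d ea eb same have ?two
        unfolding piece_eq[symmetric] folds_at_def
        by (intro fold_components[of c d]) (simp_all add: chord_share_ends)
      then show ?thesis by blast
    next
      case False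
      have sides: "odds_share x0 y0 \<in> {0, 1}" "odds_share z0 w0 \<in> {0, 1}"
        using odds_share_side chord_ends(1,5) by auto
      have half: "chord_share x0 y0 x1 y1 s \<noteq> chord_share z0 w0 z1 w1 t"
        if "s \<in> {0..1}" "t \<in> {0..1}" for s t
      proof (cases "odds_share x0 y0 = 0")
        case True
        then have "odds_share z0 w0 = 1" using sides False by auto
        then show ?thesis
          using chord_share_half(1)[OF chords(1) ea that(1) True] chord_share_half(2)[OF chords(2) eb that(2)] by simp
      next
        case nz: False
        then have "odds_share x0 y0 = 1" "odds_share z0 w0 = 0" using sides False by auto
        then show ?thesis
          using chord_share_half(2)[OF chords(1) ea that(1)] chord_share_half(1)[OF chords(2) eb that(2)] by simp
      qed
      then have "piece UNIV = {}" unfolding piece_def by force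
      moreover have "\<not> (indifference_meets (fst X) (<) \<and> indifference_meets (transpose (snd X)) (<))"
        using odds_share_eq_0_if_meets_above[OF a(1) ea] odds_share_eq_0_if_meets_above[OF b(1) eb] False by auto
      ultimately show ?thesis unfolding piece_eq by blast
    qed
  qed
  then show "dependency_equilibria X = {} \<or> ?two"
    and "indifference_meets (fst X) (<) \<Longrightarrow> indifference_meets (transpose (snd X)) (<) \<Longrightarrow> dependency_equilibria X \<noteq> {}"
    by auto
qed

lemma components_sign_condition_fails:
  assumes "generic X" "\<not> sign_condition X"
  shows "finite (components (dependency_equilibria X)) \<and> card (components (dependency_equilibria X)) \<in> {0, 1, 2} \<and>
     (\<forall>C \<in> components (dependency_equilibria X). EF_arc X C)"
proof (cases "dependency_equilibria X = {}")
  case True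
  then show ?thesis by simp
next
  case False
  then have meet: "indifference_meets (fst X) (\<lambda>_ _. True)" "indifference_meets (transpose (snd X)) (\<lambda>_ _. True)"
    using no_equilibria by blast+
  consider "crosses (fst X) \<longleftrightarrow> \<not> crosses (transpose (snd X))" | "\<not> crosses (fst X)" "\<not> crosses (transpose (snd X))"
    using assms(2) sign_condition_iff by blast
  then show ?thesis
  proof cases
    case 1
    then show ?thesis using components_one_crosses[OF assms(1) _ meet] by simp
  next
    case 2
    then obtain A B where "A \<noteq> B" "components (dependency_equilibria X) = {A, B}" "EF_arc X A" "EF_arc X B"
      using components_neither_crosses(1)[OF assms(1)] False by blast
    then show ?thesis by simp
  qed
qed

definition tie_polynomial :: "real^2^2 \<Rightarrow> real" where
  "tie_polynomial a = (a$1$1 - a$1$2) * (a$1$1 - a$2$1) * (a$1$1 - a$2$2) *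
     (a$1$2 - a$2$1) * (a$1$2 - a$2$2) * (a$2$1 - a$2$2)"

lemma no_ties_iff_tie_polynomial: "no_ties a \<longleftrightarrow> tie_polynomial a \<noteq> 0"
  by (auto simp: no_ties_def tie_polynomial_def)

lemma real_polynomial_function_entry:
  "real_polynomial_function (\<lambda>X :: game. fst X $ i $ j)" "real_polynomial_function (\<lambda>X :: game. snd X $ i $ j)"
  by (intro real_polynomial_function.intros(1) bounded_linear_compose[OF bounded_linear_vec_nth]
      bounded_linear_fst bounded_linear_snd)+

text \<open>
  Genericity is the nonvanishing of the product of all payoff differences of each player and of the
  resultant.
\<close>

lemma zariski_closed_not_generic: "zariski_closed {X. \<not> generic X}"
proof -
  define f :: "game \<Rightarrow> real" where "f = (\<lambda>X. tie_polynomial (fst X) * tie_polynomial (snd X) *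
     resultant (tangency_form (fst X)) (tangency_form (transpose (snd X))))"
  have "real_polynomial_function f"
    unfolding f_def tie_polynomial_def resultant_def tangency_form_def prod.case transpose_def
      vec_lambda_beta
    by (intro real_polynomial_function.intros(2-) real_polynomial_function_diff real_polynomial_function_power
        real_polynomial_function_entry)
  moreover have "{X. \<not> generic X} = {X. \<forall>g\<in>{f}. g X = 0}"
    by (auto simp: generic_def f_def no_ties_iff_tie_polynomial)
  ultimately show ?thesis unfolding zariski_closed_def by blast
qed

lemma transpose_mat2 [simp]: "transpose (mat2 p q r s) = mat2 p r q s"
  by (simp add: matrix2_eq_iff transpose_def)

lemma indifference_meets_mat2:
  assumes "0 < x" "x < 1" "0 < y" "y < 1" "x * p + (1 - x) * q = y * r + (1 - y) * s" "R x y"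
  shows "indifference_meets (mat2 p q r s) R"
  unfolding indifference_meets_def payoff_gap_def using assms by (intro bexI[of _ x] bexI[of _ y]) auto

text \<open>
  Every payoff in row 1 is smaller than every payoff in row 2, so player 1 is never indifferent.
\<close>

lemma generic_no_component:
  defines "X \<equiv> (mat2 0 1 2 3, mat2 3 1 0 2)"
  shows "generic X" "\<not> sign_condition X" "card (components (dependency_equilibria X)) = 0"
proof -
  show "generic X" "\<not> sign_condition X"
    by (simp_all add: X_def generic_def no_ties_def tangency_form_def resultant_def sign_condition_iff crosses_def sgn_if)
  have "payoff_gap (fst X) x y \<noteq> 0" if "x \<in> {0<..<1}" "y \<in> {0<..<1}" for x y
    using that by (auto simp: X_def payoff_gap_def)
  then have "dependency_equilibria X = {}" by (intro no_equilibria) (auto simp: indifference_meets_def)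
  then show "card (components (dependency_equilibria X)) = 0" by simp
qed

text \<open>
  Player 1's line separates \<open>(0, 0)\<close> from \<open>(1, 1)\<close>, while player 2's line cuts off the corner \<open>(0, 1)\<close>.
\<close>

lemma generic_one_component:
  defines "X \<equiv> (mat2 3 0 1 2, mat2 0 1 2 3)"
  shows "generic X" "\<not> sign_condition X" "card (components (dependency_equilibria X)) = 1"
proof -
  show gen: "generic X" "\<not> sign_condition X"
    by (simp_all add: X_def generic_def no_ties_def tangency_form_def resultant_def sign_condition_iff crosses_def sgn_if)
  have "crosses (fst X)" "\<not> crosses (transpose (snd X))"
    by (simp_all add: X_def crosses_def sgn_if)
  moreover have "indifference_meets (fst X) (\<lambda>_ _. True)" "indifference_meets (transpose (snd X)) (\<lambda>_ _. True)"
    unfolding X_def fst_conv snd_conv transpose_mat2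
    by (rule indifference_meets_mat2[of "1/2" "1/2"], simp_all, rule indifference_meets_mat2[of "1/4" "3/4"], simp_all)
  ultimately show "card (components (dependency_equilibria X)) = 1"
    using components_one_crosses(1)[OF gen(1)] by simp
qed

text \<open>
  Both lines cut off the corner \<open>(0, 1)\<close>, so both folds are below 1/2.
\<close>

lemma generic_two_components:
  defines "X \<equiv> (mat2 0 2 1 3, mat2 0 1 3 7)"
  shows "generic X" "\<not> sign_condition X" "card (components (dependency_equilibria X)) = 2"
proof -
  show gen: "generic X" "\<not> sign_condition X"
    by (simp_all add: X_def generic_def no_ties_def tangency_form_def resultant_def sign_condition_iff crosses_def sgn_if)
  have cr: "\<not> crosses (fst X)" "\<not> crosses (transpose (snd X))"
    by (simp_all add: X_def crosses_def sgn_if)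
  have "indifference_meets (fst X) (<)" "indifference_meets (transpose (snd X)) (<)"
    unfolding X_def fst_conv snd_conv transpose_mat2
    by (rule indifference_meets_mat2[of "1/4" "3/4"], simp_all, rule indifference_meets_mat2[of "1/4" "19/24"], simp_all)
  then obtain A B where "A \<noteq> B" "components (dependency_equilibria X) = {A, B}"
    using components_neither_crosses[OF gen(1) cr] by blast
  then show "card (components (dependency_equilibria X)) = 2" by simp
qed

theorem theorem14:
  "\<exists>Z :: game set. zariski_closed Z \<and> Z \<noteq> UNIV \<and>
     (\<forall>X. X \<notin> Z \<longrightarrow>
        finite (components (dependency_equilibria X)) \<and>
        card (components (dependency_equilibria X)) \<in> {0, 1, 2} \<and>
        (\<forall>C \<in> components (dependency_equilibria X). \<exists>u v. open_arc_between C u v) \<and>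
        (sign_condition X \<longrightarrow>
           (\<exists>C. components (dependency_equilibria X) = {C} \<and>
                (EE_arc C \<or> EF_arc X C \<or> FF_arc X C))) \<and>
        (\<not> sign_condition X \<longrightarrow>
           (\<forall>C \<in> components (dependency_equilibria X). EF_arc X C))) \<and>
     (\<forall>k \<in> {0, 1, 2}. \<exists>X. X \<notin> Z \<and> \<not> sign_condition X \<and>
        card (components (dependency_equilibria X)) = k)"
proof (intro exI[of _ "{X. \<not> generic X}"] conjI allI impI)
  show "zariski_closed {X. \<not> generic X}" by (rule zariski_closed_not_generic)
  show "{X. \<not> generic X} \<noteq> UNIV" using generic_no_component(1) by blast
  have arc: "\<exists>u v. open_arc_between C u v" if "EE_arc C \<or> EF_arc X C \<or> FF_arc X C" for X C
    using that unfolding EE_arc_def EF_arc_def FF_arc_def by blast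
  fix X :: game assume "X \<notin> {X. \<not> generic X}"
  then have gen: "generic X" by simp
  show one: "\<exists>C. components (dependency_equilibria X) = {C} \<and> (EE_arc C \<or> EF_arc X C \<or> FF_arc X C)"
    if "sign_condition X"
    using components_both_cross[OF gen] that by (simp add: sign_condition_iff)
  show "\<forall>C \<in> components (dependency_equilibria X). EF_arc X C" if "\<not> sign_condition X"
    using components_sign_condition_fails[OF gen that] by blast
  have "finite (components (dependency_equilibria X)) \<and> card (components (dependency_equilibria X)) \<in> {0, 1, 2} \<and>
    (\<forall>C \<in> components (dependency_equilibria X). EE_arc C \<or> EF_arc X C \<or> FF_arc X C)"
  proof (cases "sign_condition X")
    case True
    then obtain C where "components (dependency_equilibria X) = {C}" "EE_arc C \<or> EF_arc X C \<or> FF_arc X C"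
      using one by blast
    then show ?thesis by simp
  next
    case False
    then show ?thesis using components_sign_condition_fails[OF gen] by blast
  qed
  then show "finite (components (dependency_equilibria X))"
    "card (components (dependency_equilibria X)) \<in> {0, 1, 2}"
    "\<forall>C \<in> components (dependency_equilibria X). \<exists>u v. open_arc_between C u v"
    using arc by blast+
next
  show "\<forall>k \<in> {0, 1, 2}. \<exists>X. X \<notin> {X. \<not> generic X} \<and> \<not> sign_condition X \<and>
        card (components (dependency_equilibria X)) = k"
    using generic_no_component generic_one_component generic_two_components by blast
qed

end
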